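(* Let $L=[L_{j,k}(D_y)]_{m\times m}$ and $Q=[Q_{j,k}(D_y)]_{m\times m}$ be systems of pseudo-differential operators on $\mathbb{T}^N$, and let $L_\epsilon=L+\epsilon Q$, $\epsilon\in\mathbb{C}$. Let $\epsilon_0>0$ and assume that for $|\epsilon|<\epsilon_0$ the set $$Z_{\det L_\epsilon}=\{\eta\in\mathbb{Z}^N;\ \det L_\epsilon(\eta)=0\}$$ is finite, and that for all $\eta\in\mathbb{Z}^N$ the eigenvalues $\lambda_{\epsilon,1}(\eta),\dots,\lambda_{\epsilon,m}(\eta)$ of $L_\epsilon(\eta)$ can be written in the form $$\lambda_{\epsilon,j}(\eta)=\lambda_j(\eta)+\sum_{k=1}^\infty\sigma_{j,k}(\eta)\,\epsilon^k,\quad j=1,\dots,m,\ |\epsilon|<\epsilon_0,$$ where $\lambda_1(\eta),\dots,\lambda_m(\eta)$ are the eigenvalues of $L(\eta)$. Then, for $|\epsilon|<\epsilon_0$, the system $L_\epsilon$ is globally hypoelliptic if and only if there are positive constants $C_j$, $M_j$ and $R_j$ such that $$\left|\lambda_j(\eta)+\sum_{k=1}^\infty\sigma_{j,k}(\eta)\epsilon^k\right|\ge C_j|\eta|^{-M_j},\quad|\eta|\ge R_j,\ j=1,\dots,m.$$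
   Context: $\mathbb{T}=\mathbb{R}/2\pi\mathbb{Z}$. A pseudo-differential operator of order $\nu\in\mathbb{R}$ on $\mathbb{T}^N$ is $a(D_y)u(y)=\sum_{\eta\in\mathbb{Z}^N}e^{iy\cdot\eta}a(\eta)\widehat u(\eta)$, acting on functions and distributions, whose symbol satisfies $|a(\eta)|\le C|\eta|^\nu$ for all $\eta\in\mathbb{Z}^N\setminus\{0\}$, for some $C>0$. $L(\eta)=[L_{j,k}(\eta)]$, $Q(\eta)=[Q_{j,k}(\eta)]$ and $L_\epsilon(\eta)=L(\eta)+\epsilon Q(\eta)$ denote the matrix symbols. Eigenvalues are listed with multiplicity, and the series in $\epsilon$ are analytic expansions convergent for $|\epsilon|<\epsilon_0$. $\mathcal{D}'_m(\mathbb{T}^N)$ and $C^\infty_m(\mathbb{T}^N)$ are the spaces of $m$-dimensional vectors with coordinates in $\mathcal{D}'(\mathbb{T}^N)$ and $C^\infty(\mathbb{T}^N)$. A system $A$ is globally hypoelliptic if $u\in\mathcal{D}'_m(\mathbb{T}^N)$ and $Au\in C^\infty_m(\mathbb{T}^N)$ imply $u\in C^\infty_m(\mathbb{T}^N)$. *)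

theory Defs
  imports
    "HOL-Analysis.Analysis"
    "HOL-Computational_Algebra.Polynomial"
begin

section \<open>Smooth functions on the torus\<close>

text \<open>
  The torus \<open>\<bbbT>\<^sup>N = (\<real>/2\<pi>\<int>)\<^sup>N\<close> has \<open>N = CARD('n)\<close>; functions on it are functions on
  \<open>real^'n\<close> that are \<open>2\<pi>\<close>-periodic in every coordinate.
\<close>

definition partial_deriv :: "'n::finite \<Rightarrow> (real^'n \<Rightarrow> complex) \<Rightarrow> (real^'n \<Rightarrow> complex)" where
  "partial_deriv i f = (\<lambda>x. frechet_derivative f (at x) (axis i 1))"

definition partial_derivs :: "'n::finite list \<Rightarrow> (real^'n \<Rightarrow> complex) \<Rightarrow> (real^'n \<Rightarrow> complex)" where
  "partial_derivs is f = fold partial_deriv is f"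

definition torus_smooth :: "(real^'n::finite \<Rightarrow> complex) set" where
  "torus_smooth = {f.
     (\<forall>i x. f (x + axis i (2 * pi)) = f x) \<and>
     (\<forall>is x. partial_derivs is f differentiable (at x))}"

text \<open>The supremum of all derivatives of order at most \<open>k\<close>; for periodic smooth functions
  it is finite.\<close>

definition Ck_norm :: "nat \<Rightarrow> (real^'n::finite \<Rightarrow> complex) \<Rightarrow> real" where
  "Ck_norm k f = (SUP (is, x) \<in> {is. length is \<le> k} \<times> UNIV. norm (partial_derivs is f x))"


section \<open>Distributions on the torus\<close>

text \<open>
  A distribution is a continuous linear functional on \<^term>\<open>torus_smooth\<close>, whose topology is
  given by the increasing norms \<^term>\<open>Ck_norm k\<close>. It is represented by a HOL function on all
  functions; only its values on \<^term>\<open>torus_smooth\<close> are meaningful, and nothing below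
  depends on the other values.
\<close>

definition distributions :: "((real^'n::finite \<Rightarrow> complex) \<Rightarrow> complex) set" where
  "distributions = {u.
     (\<forall>\<phi>\<in>torus_smooth. \<forall>\<psi>\<in>torus_smooth. u (\<lambda>x. \<phi> x + \<psi> x) = u \<phi> + u \<psi>) \<and>
     (\<forall>c. \<forall>\<phi>\<in>torus_smooth. u (\<lambda>x. c * \<phi> x) = c * u \<phi>) \<and>
     (\<exists>C k. \<forall>\<phi>\<in>torus_smooth. norm (u \<phi>) \<le> C * Ck_norm k \<phi>)}"

definition torus_integral :: "(real^'n::finite \<Rightarrow> complex) \<Rightarrow> complex" where
  "torus_integral f = integral (cbox 0 (\<chi> i. 2 * pi)) f"

definition distribution_of :: "(real^'n::finite \<Rightarrow> complex) \<Rightarrow> (real^'n \<Rightarrow> complex) \<Rightarrow> complex" where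
  "distribution_of f = (\<lambda>\<phi>. torus_integral (\<lambda>y. f y * \<phi> y))"

definition is_smooth :: "((real^'n::finite \<Rightarrow> complex) \<Rightarrow> complex) \<Rightarrow> bool" where
  "is_smooth u \<longleftrightarrow> (\<exists>f\<in>torus_smooth. \<forall>\<phi>\<in>torus_smooth. u \<phi> = distribution_of f \<phi>)"

definition lattice_vec :: "int^'n::finite \<Rightarrow> real^'n" where
  "lattice_vec \<eta> = (\<chi> i. real_of_int (\<eta> $ i))"

definition character :: "int^'n::finite \<Rightarrow> real^'n \<Rightarrow> complex" where
  "character \<eta> = (\<lambda>y. exp (\<i> * complex_of_real (y \<bullet> lattice_vec \<eta>)))"

definition fourier_coeff ::
  "((real^'n::finite \<Rightarrow> complex) \<Rightarrow> complex) \<Rightarrow> int^'n \<Rightarrow> complex" where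
  "fourier_coeff u \<eta> = u (character (- \<eta>)) / complex_of_real ((2 * pi) ^ CARD('n))"


section \<open>Systems of pseudo-differential operators\<close>

definition symbol_of_order :: "real \<Rightarrow> (int^'n::finite \<Rightarrow> complex) \<Rightarrow> bool" where
  "symbol_of_order \<nu> a \<longleftrightarrow>
     (\<exists>C>0. \<forall>\<eta>. \<eta> \<noteq> 0 \<longrightarrow> norm (a \<eta>) \<le> C * norm (lattice_vec \<eta>) powr \<nu>)"

definition symbol_system :: "(int^'n::finite \<Rightarrow> complex^'m^'m::finite) \<Rightarrow> bool" where
  "symbol_system A \<longleftrightarrow> (\<forall>j k. \<exists>\<nu>. symbol_of_order \<nu> (\<lambda>\<eta>. A \<eta> $ j $ k))"

text \<open>
  The Fourier series of the image converges in the sense of distributions, that is,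
  after pairing each term with a test function.
\<close>

definition psido :: "(int^'n::finite \<Rightarrow> complex) \<Rightarrow>
    ((real^'n \<Rightarrow> complex) \<Rightarrow> complex) \<Rightarrow> ((real^'n \<Rightarrow> complex) \<Rightarrow> complex)" where
  "psido a u = (\<lambda>\<phi>. \<Sum>\<^sub>\<infinity>\<eta>. a \<eta> * fourier_coeff u \<eta> * distribution_of (character \<eta>) \<phi>)"

definition psido_system :: "(int^'n::finite \<Rightarrow> complex^'m^'m::finite) \<Rightarrow>
    ('m \<Rightarrow> (real^'n \<Rightarrow> complex) \<Rightarrow> complex) \<Rightarrow> ('m \<Rightarrow> (real^'n \<Rightarrow> complex) \<Rightarrow> complex)" where
  "psido_system A u = (\<lambda>j \<phi>. \<Sum>k\<in>UNIV. psido (\<lambda>\<eta>. A \<eta> $ j $ k) (u k) \<phi>)"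

definition globally_hypoelliptic :: "(int^'n::finite \<Rightarrow> complex^'m^'m::finite) \<Rightarrow> bool" where
  "globally_hypoelliptic A \<longleftrightarrow>
     (\<forall>u. (\<forall>j. u j \<in> distributions) \<longrightarrow> (\<forall>j. is_smooth (psido_system A u j)) \<longrightarrow>
          (\<forall>j. is_smooth (u j)))"

definition perturbed :: "(int^'n::finite \<Rightarrow> complex^'m^'m::finite) \<Rightarrow>
    (int^'n \<Rightarrow> complex^'m^'m) \<Rightarrow> complex \<Rightarrow> int^'n \<Rightarrow> complex^'m^'m" where
  "perturbed L Q \<epsilon> \<eta> = (\<chi> j k. L \<eta> $ j $ k + \<epsilon> * Q \<eta> $ j $ k)"


section \<open>Eigenvalues with multiplicity\<close>

definition charpoly :: "complex^'m^'m::finite \<Rightarrow> complex poly" where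
  "charpoly A = det (mat [:0, 1:] - (\<chi> j k. [:A $ j $ k:]))"

definition eigenvalue_list :: "complex^'m^'m::finite \<Rightarrow> ('m \<Rightarrow> complex) \<Rightarrow> bool" where
  "eigenvalue_list A ev \<longleftrightarrow> charpoly A = (\<Prod>j\<in>UNIV. [:- ev j, 1:])"

end

theory Submission
  imports Defs
begin

text \<open>
  On the Fourier side \<open>A(D)\<close> multiplies the vector of Fourier coefficients by the matrix
  \<open>A(\<eta>)\<close>. A polynomially bounded sequence is the coefficient sequence of a distribution, and a
  distribution is smooth iff its coefficients decay rapidly. If the eigenvalues are bounded below
  polynomially, then so is \<open>det A(\<eta>)\<close>, their product up to sign, and Cramer's rule transfers rapid
  decay from \<open>A u\<close> to \<open>u\<close>. If the bound fails for the \<open>j\<close>-th eigenvalue, there are lattice points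
  \<open>\<eta>\<^sub>l\<close> tending to infinity along which it decays rapidly; placing normalised eigenvectors of
  \<open>A(\<eta>\<^sub>l)\<close> at these frequencies gives a distribution that is not smooth although its image is.
\<close>

section \<open>Polynomial growth and rapid decay of sequences on the lattice\<close>

text \<open>The theorem speaks of functionals on smooth functions, the linear algebra of coefficient
  sequences. Returning from sequences to functionals requires that a distribution be determined by
  its coefficients. For this the test function is expanded rather than the distribution, which needs
  Fourier inversion for smooth functions only; that in turn rests on completeness of the characters,
  obtained from Stone-Weierstrass. One integration-by-parts estimate, explicit in
  \<open>Ck_norm\<close>, gives both the decay of the coefficients of a smooth function and the
  continuity of a functional built from polynomially bounded coefficients.

  For a matrix that is not normal, lower bounds on the eigenvalues alone do not control the inverse;
  polynomial growth of the entries bounds the cofactors and closes the gap. In the converse, the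
  coordinate in which an eigenvector is largest varies with the lattice point, so the final
  contradiction takes a maximum over the finitely many coordinates.

  The weight is 1 + |\<eta>| because it is at least 1 even at the origin, which makes its powers
  monotone in the exponent.\<close>

definition bracket :: "int^'n::finite \<Rightarrow> real" where
  "bracket \<eta> = 1 + norm (lattice_vec \<eta>)"

definition poly_bounded :: "(int^'n::finite \<Rightarrow> complex) \<Rightarrow> bool" where
  "poly_bounded c \<longleftrightarrow> (\<exists>C n. \<forall>\<eta>. norm (c \<eta>) \<le> C * bracket \<eta> ^ n)"

definition rapidly_decaying :: "(int^'n::finite \<Rightarrow> complex) \<Rightarrow> bool" where
  "rapidly_decaying c \<longleftrightarrow> (\<forall>n. \<exists>C. \<forall>\<eta>. norm (c \<eta>) * bracket \<eta> ^ n \<le> C)"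

lemma bracket_ge_1: "1 \<le> bracket \<eta>"
  by (simp add: bracket_def)

lemma bracket_pos: "0 < bracket \<eta>"
  using bracket_ge_1[of \<eta>] by linarith

lemma lattice_vec_uminus: "lattice_vec (- \<eta>) = - lattice_vec \<eta>"
  by (simp add: lattice_vec_def vec_eq_iff)

lemma bracket_uminus: "bracket (- \<eta>) = bracket \<eta>"
  by (simp add: bracket_def lattice_vec_uminus)

lemma bracket_power_mono: "m \<le> n \<Longrightarrow> bracket \<eta> ^ m \<le> bracket \<eta> ^ n"
  by (simp add: bracket_ge_1 power_increasing)

lemma abs_component_le_bracket: "\<bar>real_of_int (\<eta> $ i)\<bar> \<le> bracket \<eta>"
  using component_le_norm_cart[of "lattice_vec \<eta>" i] by (simp add: bracket_def lattice_vec_def)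

lemma finite_bounded_lattice: "finite {\<eta> :: int^'n::finite. norm (lattice_vec \<eta>) \<le> r}"
proof -
  let ?B = "PiE (UNIV :: 'n set) (\<lambda>_. {- \<lceil>r\<rceil>..\<lceil>r\<rceil>})"
  have "{\<eta> :: int^'n. norm (lattice_vec \<eta>) \<le> r} \<subseteq> vec_lambda ` ?B"
  proof
    fix \<eta> :: "int^'n" assume "\<eta> \<in> {\<eta>. norm (lattice_vec \<eta>) \<le> r}"
    then have "\<bar>real_of_int (\<eta> $ i)\<bar> \<le> r" for i
      using component_le_norm_cart[of "lattice_vec \<eta>" i] by (simp add: lattice_vec_def)
    then have "\<eta> $ i \<in> {- \<lceil>r\<rceil>..\<lceil>r\<rceil>}" for i
      by (smt (verit) atLeastAtMost_iff le_of_int_ceiling of_int_le_iff of_int_minus)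
    then have "vec_nth \<eta> \<in> ?B" by auto
    then show "\<eta> \<in> vec_lambda ` ?B"
      by (metis imageI vec_nth_inverse)
  qed
  then show ?thesis
    by (rule finite_subset) (intro finite_imageI finite_PiE; simp)
qed

lemma norm_lattice_vec_ge_1: "\<eta> \<noteq> 0 \<Longrightarrow> 1 \<le> norm (lattice_vec \<eta>)"
proof -
  assume "\<eta> \<noteq> 0"
  then obtain i where "\<eta> $ i \<noteq> 0" by (auto simp: vec_eq_iff)
  then have "1 \<le> \<bar>lattice_vec \<eta> $ i\<bar>"
    by (simp add: lattice_vec_def)
  then show ?thesis using component_le_norm_cart[of "lattice_vec \<eta>" i] by linarith
qed

text \<open>The right-hand side is chosen to telescope: passing from m to m + 1 adds the two terms
  at z = m + 1 and z = -(m + 1), and their sum is at most 4/(m+1) - 4/(m+2). At m = 0 both sides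
  equal 1.\<close>

lemma sum_inverse_square_le: "(\<Sum>z\<in>{- int m..int m}. 1 / (1 + (real_of_int z)\<^sup>2)) \<le> 5 - 4 / (real m + 1)"
proof (induction m)
  case (Suc m)
  have "{- int (Suc m)..int (Suc m)} = insert (int (Suc m)) (insert (- int (Suc m)) {- int m..int m})"
    by auto
  moreover have "2 / (1 + (real m + 1)\<^sup>2) \<le> 4 / (real m + 1) - 4 / (real m + 2)"
  proof -
    have "2 / (1 + (real m + 1)\<^sup>2) = 4 / (2 * (1 + (real m + 1)\<^sup>2))"
    proof -
      have "2 / X = 4 / (2 * X)" for X :: real by (cases "X = 0") auto
      then show ?thesis .
    qed
    also have "\<dots> \<le> 4 / ((real m + 1) * (real m + 2))"
      by (intro divide_left_mono mult_pos_pos) (auto simp: power2_eq_square algebra_simps add_pos_nonneg)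
    also have "\<dots> = 4 / (real m + 1) - 4 / (real m + 2)"
      by (simp add: field_simps)
    finally show ?thesis .
  qed
  moreover have "(- 1 - real m)\<^sup>2 = (real m + 1)\<^sup>2"
    by (simp add: power2_eq_square algebra_simps)
  ultimately show ?case using Suc.IH by (simp add: add_ac)
qed simp

text \<open>Every coordinate is bounded by the norm, so one factor
  \<open>1 / (bracket \<eta>)\<^sup>2\<close> can be spent on each coordinate; this is where the
  exponent 2N comes from. The resulting product weight, summed over a box, factors into
  one-dimensional sums, each at most 5.\<close>

lemma summable_bracket: "(\<lambda>\<eta> :: int^'n::finite. 1 / bracket \<eta> ^ (2 * CARD('n))) summable_on UNIV"
proof (rule nonneg_bdd_above_summable_on)
  define w where "w z = 1 / (1 + (real_of_int z)\<^sup>2)" for z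
  have w0: "0 \<le> w z" for z by (simp add: w_def)
  have bw: "1 / bracket \<eta> ^ (2 * CARD('n)) \<le> (\<Prod>i\<in>UNIV. w (\<eta> $ i))" for \<eta> :: "int^'n"
  proof -
    have "1 / (bracket \<eta>)\<^sup>2 \<le> w (\<eta> $ i)" for i
    proof -
      have "(real_of_int (\<eta> $ i))\<^sup>2 \<le> (norm (lattice_vec \<eta>))\<^sup>2"
        using component_le_norm_cart[of "lattice_vec \<eta>" i]
        by (auto simp: lattice_vec_def intro!: iffD1[OF abs_le_square_iff])
      then have "1 + (real_of_int (\<eta> $ i))\<^sup>2 \<le> (bracket \<eta>)\<^sup>2"
        unfolding bracket_def by (simp add: power2_sum add_increasing2)
      then show ?thesis unfolding w_def
        by (intro divide_left_mono) (auto intro!: mult_pos_pos simp: bracket_pos[THEN less_imp_neq, symmetric] add_pos_nonneg)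
    qed
    then have "(\<Prod>i\<in>(UNIV::'n set). 1 / (bracket \<eta>)\<^sup>2) \<le> (\<Prod>i\<in>UNIV. w (\<eta> $ i))"
      by (intro prod_mono) auto
    then show ?thesis by (simp add: power_mult power_one_over)
  qed
  show "bdd_above (sum (\<lambda>\<eta> :: int^'n. 1 / bracket \<eta> ^ (2 * CARD('n))) ` {F. F \<subseteq> UNIV \<and> finite F})"
  proof (rule bdd_aboveI2)
    fix F :: "(int^'n) set" assume "F \<in> {F. F \<subseteq> UNIV \<and> finite F}"
    then have F: "finite F" by simp
    define m where "m = Max (insert 0 ((\<lambda>(\<eta>, i). nat \<bar>\<eta> $ i\<bar>) ` (F \<times> (UNIV :: 'n set))))"
    have mm: "nat \<bar>\<eta> $ i\<bar> \<le> m" if "\<eta> \<in> F" for \<eta> i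
      unfolding m_def using F that by (intro Max_ge) auto
    let ?B = "PiE (UNIV :: 'n set) (\<lambda>_. {- int m..int m})"
    have sub: "vec_nth ` F \<subseteq> ?B"
    proof -
      have "\<eta> $ i \<in> {- int m..int m}" if "\<eta> \<in> F" for \<eta> i
        using mm[OF that, of i] by auto
      then show ?thesis by (auto simp: PiE_def)
    qed
    have "(\<Sum>\<eta>\<in>F. 1 / bracket \<eta> ^ (2 * CARD('n))) \<le> (\<Sum>\<eta>\<in>F. \<Prod>i\<in>UNIV. w (\<eta> $ i))"
      by (intro sum_mono bw)
    also have "\<dots> = (\<Sum>g\<in>vec_nth ` F. \<Prod>i\<in>UNIV. w (g i))"
      by (subst sum.reindex) (auto simp: inj_on_def vec_nth_inject)
    also have "\<dots> \<le> (\<Sum>g\<in>?B. \<Prod>i\<in>UNIV. w (g i))"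
      by (intro sum_mono2 finite_PiE sub) (auto intro!: prod_nonneg w0)
    also have "\<dots> = (\<Prod>i\<in>(UNIV::'n set). \<Sum>z\<in>{- int m..int m}. w z)"
      by (subst prod_sum_PiE) auto
    also have "\<dots> \<le> (\<Prod>i\<in>(UNIV::'n set). 5)"
    proof (intro prod_mono conjI sum_nonneg w0)
      have "(\<Sum>z\<in>{- int m..int m}. w z) \<le> 5 - 4 / (real m + 1)"
        unfolding w_def by (rule sum_inverse_square_le)
      also have "\<dots> \<le> 5" by simp
      finally show "(\<Sum>z\<in>{- int m..int m}. w z) \<le> 5" .
    qed
    finally show "(\<Sum>\<eta>\<in>F. 1 / bracket \<eta> ^ (2 * CARD('n))) \<le> 5 ^ CARD('n)" by simp
  qed
qed (simp add: bracket_def)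

section \<open>Algebra of rapidly decaying and polynomially bounded sequences\<close>

lemma rapidly_decaying_summable:
  assumes "rapidly_decaying (c :: int^'n::finite \<Rightarrow> complex)"
  shows "(\<lambda>\<eta>. norm (c \<eta>) * bracket \<eta> ^ k) summable_on UNIV"
proof -
  \<comment> \<open>Of the available decay, 2N orders beyond k pay for summability over the
    lattice.\<close>
  obtain C where C: "norm (c \<eta>) * bracket \<eta> ^ (k + 2 * CARD('n)) \<le> C" for \<eta>
    using assms unfolding rapidly_decaying_def by blast
  have "(\<lambda>\<eta> :: int^'n. C * (1 / bracket \<eta> ^ (2 * CARD('n)))) summable_on UNIV"
    by (intro summable_on_cmult_right summable_bracket)
  then show ?thesis
  proof (rule summable_on_comparison_test)
    fix \<eta> :: "int^'n"
    show "norm (c \<eta>) * bracket \<eta> ^ k \<le> C * (1 / bracket \<eta> ^ (2 * CARD('n)))"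
      using C[of \<eta>] bracket_pos[of \<eta>] by (simp add: power_add field_simps)
    show "0 \<le> norm (c \<eta>) * bracket \<eta> ^ k" using bracket_pos[of \<eta>] by simp
  qed
qed

lemma rapidly_decaying_summable_norm:
  "rapidly_decaying c \<Longrightarrow> (\<lambda>\<eta>. norm (c \<eta>)) summable_on UNIV"
  using rapidly_decaying_summable[of c 0] by simp

lemma rapidly_decaying_mult:
  assumes "rapidly_decaying c" "poly_bounded a"
  shows "rapidly_decaying (\<lambda>\<eta>. a \<eta> * c \<eta>)"
  unfolding rapidly_decaying_def
proof
  fix n
  obtain A m where A: "norm (a \<eta>) \<le> A * bracket \<eta> ^ m" for \<eta>
    using assms(2) unfolding poly_bounded_def by blast
  obtain C where C: "norm (c \<eta>) * bracket \<eta> ^ (m + n) \<le> C" for \<eta>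
    using assms(1) unfolding rapidly_decaying_def by blast
  have "norm (a \<eta> * c \<eta>) * bracket \<eta> ^ n \<le> \<bar>A\<bar> * C" for \<eta>
  proof -
    have "norm (a \<eta>) \<le> \<bar>A\<bar> * bracket \<eta> ^ m"
      using A[of \<eta>] bracket_pos[of \<eta>] by (smt (verit) mult_right_mono zero_le_power)
    then have "norm (a \<eta> * c \<eta>) * bracket \<eta> ^ n \<le> (\<bar>A\<bar> * bracket \<eta> ^ m) * norm (c \<eta>) * bracket \<eta> ^ n"
      unfolding norm_mult using bracket_pos[of \<eta>] by (intro mult_right_mono) auto
    also have "\<dots> = \<bar>A\<bar> * (norm (c \<eta>) * bracket \<eta> ^ (m + n))"
      by (simp add: power_add)
    also have "\<dots> \<le> \<bar>A\<bar> * C" by (intro mult_left_mono C) simp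
    finally show ?thesis .
  qed
  then show "\<exists>C. \<forall>\<eta>. norm (a \<eta> * c \<eta>) * bracket \<eta> ^ n \<le> C" by blast
qed

lemma rapidly_decaying_le:
  assumes "rapidly_decaying c" "\<And>\<eta>. norm (d \<eta>) \<le> norm (c \<eta>)"
  shows "rapidly_decaying d"
  unfolding rapidly_decaying_def
proof
  fix n
  obtain C where C: "norm (c \<eta>) * bracket \<eta> ^ n \<le> C" for \<eta>
    using assms(1) unfolding rapidly_decaying_def by blast
  have "norm (d \<eta>) * bracket \<eta> ^ n \<le> C" for \<eta>
    using C[of \<eta>] assms(2)[of \<eta>] bracket_pos[of \<eta>]
    by (meson mult_right_mono order_trans zero_le_power less_imp_le)
  then show "\<exists>C. \<forall>\<eta>. norm (d \<eta>) * bracket \<eta> ^ n \<le> C" by blast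
qed

lemma rapidly_decaying_add:
  assumes "rapidly_decaying c" "rapidly_decaying d"
  shows "rapidly_decaying (\<lambda>\<eta>. c \<eta> + d \<eta>)"
  unfolding rapidly_decaying_def
proof
  fix n
  obtain C D where C: "norm (c \<eta>) * bracket \<eta> ^ n \<le> C" and D: "norm (d \<eta>) * bracket \<eta> ^ n \<le> D" for \<eta>
    using assms unfolding rapidly_decaying_def by metis
  have "norm (c \<eta> + d \<eta>) * bracket \<eta> ^ n \<le> C + D" for \<eta>
  proof -
    have "norm (c \<eta> + d \<eta>) * bracket \<eta> ^ n \<le> (norm (c \<eta>) + norm (d \<eta>)) * bracket \<eta> ^ n"
      using bracket_pos[of \<eta>] by (intro mult_right_mono norm_triangle_ineq) auto
    also have "\<dots> \<le> C + D" unfolding distrib_right by (intro add_mono C D)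
    finally show ?thesis .
  qed
  then show "\<exists>C. \<forall>\<eta>. norm (c \<eta> + d \<eta>) * bracket \<eta> ^ n \<le> C" by blast
qed

lemma rapidly_decaying_sum:
  "(\<And>i. i \<in> I \<Longrightarrow> rapidly_decaying (c i)) \<Longrightarrow> rapidly_decaying (\<lambda>\<eta>. \<Sum>i\<in>I. c i \<eta>)"
proof (induction I rule: infinite_finite_induct)
  case (insert i I)
  then show ?case by (auto intro: rapidly_decaying_add)
qed (auto simp: rapidly_decaying_def)

lemma poly_bounded_const: "poly_bounded (\<lambda>_. a)"
  unfolding poly_bounded_def by (rule exI[of _ "norm a"], rule exI[of _ 0]) simp

text \<open>Multiplying two bounds requires nonnegative constants. The definition does not fix the
  sign, but the bound at the origin forces it.\<close>

lemma poly_bounded_nonneg: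
  assumes "poly_bounded (c :: int^'n::finite \<Rightarrow> complex)"
  obtains C n where "0 \<le> C" "\<And>\<eta>. norm (c \<eta>) \<le> C * bracket \<eta> ^ n"
proof -
  obtain C n where C: "norm (c \<eta>) \<le> C * bracket \<eta> ^ n" for \<eta>
    using assms unfolding poly_bounded_def by blast
  moreover have "0 \<le> C * bracket (0 :: int^'n) ^ n" by (rule order_trans[OF norm_ge_zero C])
  then have "0 \<le> C" using bracket_pos[of "0 :: int^'n"] by (smt (verit) zero_le_mult_iff zero_less_power)
  ultimately show ?thesis using that by blast
qed

lemma poly_bounded_mult:
  assumes "poly_bounded c" "poly_bounded d"
  shows "poly_bounded (\<lambda>\<eta>. c \<eta> * d \<eta>)"
proof -
  obtain C m where C: "0 \<le> C" "\<And>\<eta>. norm (c \<eta>) \<le> C * bracket \<eta> ^ m"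
    using poly_bounded_nonneg[OF assms(1)] by blast
  obtain D n where D: "0 \<le> D" "\<And>\<eta>. norm (d \<eta>) \<le> D * bracket \<eta> ^ n"
    using poly_bounded_nonneg[OF assms(2)] by blast
  have "norm (c \<eta> * d \<eta>) \<le> (C * D) * bracket \<eta> ^ (m + n)" for \<eta>
  proof -
    have "norm (c \<eta> * d \<eta>) \<le> (C * bracket \<eta> ^ m) * (D * bracket \<eta> ^ n)"
      unfolding norm_mult using C D bracket_pos[of \<eta>] by (intro mult_mono) auto
    then show ?thesis by (simp add: power_add mult_ac)
  qed
  then show ?thesis unfolding poly_bounded_def by blast
qed

lemma poly_bounded_add:
  assumes "poly_bounded c" "poly_bounded d"
  shows "poly_bounded (\<lambda>\<eta>. c \<eta> + d \<eta>)"
proof -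
  obtain C m where C: "0 \<le> C" "\<And>\<eta>. norm (c \<eta>) \<le> C * bracket \<eta> ^ m"
    using poly_bounded_nonneg[OF assms(1)] by blast
  obtain D n where D: "0 \<le> D" "\<And>\<eta>. norm (d \<eta>) \<le> D * bracket \<eta> ^ n"
    using poly_bounded_nonneg[OF assms(2)] by blast
  have "norm (c \<eta> + d \<eta>) \<le> (C + D) * bracket \<eta> ^ (m + n)" for \<eta>
  proof -
    have "norm (c \<eta>) \<le> C * bracket \<eta> ^ (m + n)"
      using C(1) by (intro order_trans[OF C(2)] mult_left_mono bracket_power_mono) auto
    moreover have "norm (d \<eta>) \<le> D * bracket \<eta> ^ (m + n)"
      using D(1) by (intro order_trans[OF D(2)] mult_left_mono bracket_power_mono) auto
    ultimately show ?thesis by (simp add: distrib_right norm_triangle_le)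
  qed
  then show ?thesis unfolding poly_bounded_def by blast
qed

lemma poly_bounded_prod:
  "(\<And>i. i \<in> I \<Longrightarrow> poly_bounded (c i)) \<Longrightarrow> poly_bounded (\<lambda>\<eta>. \<Prod>i\<in>I. c i \<eta>)"
proof (induction I rule: infinite_finite_induct)
  case (insert i I)
  then show ?case by (auto intro: poly_bounded_mult)
qed (auto intro: poly_bounded_const)

lemma symbol_of_order_poly_bounded:
  fixes a :: "int^'n::finite \<Rightarrow> complex"
  assumes "symbol_of_order \<nu> a"
  shows "poly_bounded a"
proof -
  obtain C where C: "C > 0" "\<And>\<eta>. \<eta> \<noteq> 0 \<Longrightarrow> norm (a \<eta>) \<le> C * norm (lattice_vec \<eta>) powr \<nu>"
    using assms unfolding symbol_of_order_def by blast
  \<comment> \<open>A negative order is rounded up to the exponent 0, which is harmless since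
    |\<eta>| is at least 1 away from the origin. The origin itself, left free by the symbol
    estimate, is covered by adding \<open>norm (a 0)\<close> to the constant.\<close>
  define n where "n = nat \<lceil>\<nu>\<rceil>"
  have "norm (a \<eta>) \<le> (C + norm (a 0)) * bracket \<eta> ^ n" for \<eta>
  proof (cases "\<eta> = 0")
    case True
    have "norm (a 0) * 1 \<le> (C + norm (a 0)) * bracket (0 :: int^'n) ^ n"
      using C(1) bracket_ge_1[of "0 :: int^'n"] by (intro mult_mono) auto
    then show ?thesis using True by simp
  next
    case False
    then have 1: "1 \<le> norm (lattice_vec \<eta>)" by (rule norm_lattice_vec_ge_1)
    have "norm (lattice_vec \<eta>) powr \<nu> \<le> norm (lattice_vec \<eta>) powr real n"
      using 1 unfolding n_def by (intro powr_mono) linarith+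
    also have "\<dots> = norm (lattice_vec \<eta>) ^ n" using 1 by (intro powr_realpow) linarith
    also have "\<dots> \<le> bracket \<eta> ^ n" unfolding bracket_def by (intro power_mono) auto
    finally have "C * norm (lattice_vec \<eta>) powr \<nu> \<le> (C + norm (a 0)) * bracket \<eta> ^ n"
      using C(1) by (intro mult_mono) auto
    with C(2)[OF False] show ?thesis by linarith
  qed
  then show ?thesis unfolding poly_bounded_def by blast
qed

section \<open>Fourier series with rapidly decaying coefficients\<close>

definition fourier_series :: "(int^'n::finite \<Rightarrow> complex) \<Rightarrow> real^'n \<Rightarrow> complex" where
  "fourier_series c x = (\<Sum>\<^sub>\<infinity>\<eta>. c \<eta> * character \<eta> x)"

lemma has_sum_sum_infsum:
  fixes f :: "'i \<Rightarrow> 'a \<Rightarrow> 'b::{t2_space, topological_comm_monoid_add}"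
  assumes "\<And>i. i \<in> I \<Longrightarrow> f i summable_on A"
  shows "((\<lambda>x. \<Sum>i\<in>I. f i x) has_sum (\<Sum>i\<in>I. infsum (f i) A)) A"
  using assms by (induction I rule: infinite_finite_induct) (auto intro!: has_sum_add)

lemma has_sum_minus:
  fixes f g :: "'a \<Rightarrow> 'b::topological_ab_group_add"
  assumes "(f has_sum a) A" "(g has_sum b) A"
  shows "((\<lambda>x. f x - g x) has_sum (a - b)) A"
  using has_sum_add[OF assms(1), of "\<lambda>x. - g x" "- b"] assms(2) by (simp add: has_sum_uminus)

lemma lattice_vec_add: "lattice_vec (\<eta> + \<xi>) = lattice_vec \<eta> + lattice_vec \<xi>"
  by (simp add: lattice_vec_def vec_eq_iff)

lemma norm_character: "norm (character \<eta> x) = 1"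
  by (simp add: character_def)

lemma character_add: "character (\<eta> + \<xi>) x = character \<eta> x * character \<xi> x"
  by (simp add: character_def lattice_vec_add inner_add_right distrib_left exp_add)

lemma character_0: "character 0 x = 1"
proof -
  have "lattice_vec (0 :: int^'a) = 0" by (simp add: lattice_vec_def vec_eq_iff)
  then show ?thesis by (simp add: character_def)
qed

lemma character_periodic: "character \<eta> (x + axis i (2 * pi)) = character \<eta> x"
proof -
  have "(x + axis i (2 * pi)) \<bullet> lattice_vec \<eta> = x \<bullet> lattice_vec \<eta> + 2 * pi * of_int (\<eta> $ i)"
    by (simp add: inner_add_left inner_axis' lattice_vec_def)
  moreover have "exp (\<i> * complex_of_real (2 * pi * of_int (\<eta> $ i))) = 1"
    using exp_integer_2pi[of "of_int (\<eta> $ i)"] by (simp add: mult_ac)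
  ultimately show ?thesis by (simp add: character_def distrib_left exp_add)
qed

lemma fourier_series_summable:
  assumes "(\<lambda>\<eta>. norm (c \<eta>)) summable_on A"
  shows "(\<lambda>\<eta>. c \<eta> * character \<eta> x) summable_on A"
  by (rule abs_summable_summable) (simp add: norm_mult norm_character assms)

lemma norm_fourier_series_le:
  assumes "(\<lambda>\<eta>. norm (c \<eta>)) summable_on UNIV"
  shows "norm (fourier_series c x) \<le> (\<Sum>\<^sub>\<infinity>\<eta>. norm (c \<eta>))"
  using norm_infsum_bound[of "\<lambda>\<eta>. c \<eta> * character \<eta> x" UNIV] assms
  by (simp add: fourier_series_def norm_mult norm_character)

lemma poly_bounded_component: "poly_bounded (\<lambda>\<eta>. \<i> * of_int (\<eta> $ i))"
proof -
  have "norm (\<i> * of_int (\<eta> $ i)) \<le> 1 * bracket \<eta> ^ 1" for \<eta> :: "int^'a"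
    using abs_component_le_bracket[of \<eta> i] by (simp add: norm_mult)
  then show ?thesis unfolding poly_bounded_def by blast
qed

text \<open>The Taylor remainder carries a factor exp |Re z|, which is 1 on the imaginary axis;
  hence a bound that is uniform in \<open>t\<close>.\<close>

lemma norm_exp_i_minus_linear_le: "norm (exp (\<i> * complex_of_real t) - 1 - \<i> * complex_of_real t) \<le> t\<^sup>2"
  using Taylor_exp[of "\<i> * complex_of_real t" 1] by (simp add: norm_mult diff_diff_eq power2_eq_square)

text \<open>Instead of differentiating term by term and checking uniform convergence, the whole
  remainder is written as a single series. The second-order remainder of each character is at most
  (|h| |\<eta>|)^2, so the sum is O(|h|^2).\<close>

lemma fourier_series_has_derivative:
  fixes c :: "int^'n::finite \<Rightarrow> complex"
  assumes "rapidly_decaying c"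
  shows "(fourier_series c has_derivative
    (\<lambda>h. \<Sum>i\<in>UNIV. of_real (h $ i) * fourier_series (\<lambda>\<eta>. \<i> * of_int (\<eta> $ i) * c \<eta>) x)) (at x)"
    (is "(_ has_derivative ?D) _")
  unfolding has_derivative_at
proof
  show "bounded_linear ?D"
    by (intro bounded_linear_sum bounded_linear_mult_const bounded_linear_compose[OF bounded_linear_of_real]
        bounded_linear_vec_nth)
  \<comment> \<open>The second moment of the coefficients, finite by rapid decay, is the constant in
    the quadratic remainder.\<close>
  define K where "K = (\<Sum>\<^sub>\<infinity>\<eta>. norm (c \<eta>) * bracket \<eta> ^ 2)"
  have bound: "norm (fourier_series c (x + h) - fourier_series c x - ?D h) \<le> K * (norm h)\<^sup>2" for h
  proof -
    have sum1: "(\<lambda>\<eta>. of_real (h $ i) * (\<i> * of_int (\<eta> $ i) * c \<eta> * character \<eta> x)) summable_on UNIV" for i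
      by (intro summable_on_cmult_right fourier_series_summable rapidly_decaying_summable_norm
          rapidly_decaying_mult assms poly_bounded_component)
    have "?D h = (\<Sum>i\<in>UNIV. \<Sum>\<^sub>\<infinity>\<eta>. of_real (h $ i) * (\<i> * of_int (\<eta> $ i) * c \<eta> * character \<eta> x))"
      by (simp add: fourier_series_def infsum_cmult_right')
    also have "\<dots> = (\<Sum>\<^sub>\<infinity>\<eta>. \<Sum>i\<in>UNIV. of_real (h $ i) * (\<i> * of_int (\<eta> $ i) * c \<eta> * character \<eta> x))"
      using has_sum_sum_infsum[OF sum1] by (rule infsumI[symmetric])
    also have "(\<lambda>\<eta>. \<Sum>i\<in>UNIV. of_real (h $ i) * (\<i> * of_int (\<eta> $ i) * c \<eta> * character \<eta> x)) =
      (\<lambda>\<eta>. c \<eta> * character \<eta> x * (\<i> * of_real (h \<bullet> lattice_vec \<eta>)))"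
      by (simp add: fun_eq_iff inner_vec_def lattice_vec_def sum_distrib_left mult_ac)
    finally have D: "?D h = (\<Sum>\<^sub>\<infinity>\<eta>. c \<eta> * character \<eta> x * (\<i> * of_real (h \<bullet> lattice_vec \<eta>)))" .
    have sumD: "(\<lambda>\<eta>. c \<eta> * character \<eta> x * (\<i> * of_real (h \<bullet> lattice_vec \<eta>))) summable_on UNIV"
    proof -
      have "(\<lambda>\<eta>. \<Sum>i\<in>UNIV. of_real (h $ i) * (\<i> * of_int (\<eta> $ i) * c \<eta> * character \<eta> x)) summable_on UNIV"
        using has_sum_sum_infsum[OF sum1] by (rule has_sum_imp_summable)
      then show ?thesis
        by (simp add: fun_eq_iff inner_vec_def lattice_vec_def sum_distrib_left mult_ac)
    qed
    have s0: "(\<lambda>\<eta>. c \<eta> * character \<eta> y) summable_on UNIV" for y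
      by (intro fourier_series_summable rapidly_decaying_summable_norm assms)
    let ?r = "\<lambda>\<eta>. c \<eta> * character \<eta> x *
      (exp (\<i> * of_real (h \<bullet> lattice_vec \<eta>)) - 1 - \<i> * of_real (h \<bullet> lattice_vec \<eta>))"
    have "fourier_series c (x + h) - fourier_series c x - ?D h =
      (\<Sum>\<^sub>\<infinity>\<eta>. c \<eta> * character \<eta> (x + h) - c \<eta> * character \<eta> x
        - c \<eta> * character \<eta> x * (\<i> * of_real (h \<bullet> lattice_vec \<eta>)))"
      unfolding D unfolding fourier_series_def
      by (intro infsumI[symmetric] has_sum_minus has_sum_infsum s0 sumD)
    also have "\<dots> = infsum ?r UNIV"
      by (simp add: character_def inner_add_left distrib_left exp_add algebra_simps)
    finally have eq: "fourier_series c (x + h) - fourier_series c x - ?D h = infsum ?r UNIV" .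
    have rle: "norm (?r \<eta>) \<le> (norm h)\<^sup>2 * (norm (c \<eta>) * bracket \<eta> ^ 2)" for \<eta>
    proof -
      have "\<bar>h \<bullet> lattice_vec \<eta>\<bar> \<le> norm h * norm (lattice_vec \<eta>)" by (rule Cauchy_Schwarz_ineq2)
      also have "\<dots> \<le> norm h * bracket \<eta>"
        by (intro mult_left_mono) (auto simp: bracket_def)
      finally have "(h \<bullet> lattice_vec \<eta>)\<^sup>2 \<le> (norm h * bracket \<eta>)\<^sup>2"
        using bracket_pos[of \<eta>] by (subst abs_le_square_iff[symmetric]) simp
      then have "norm (exp (\<i> * of_real (h \<bullet> lattice_vec \<eta>)) - 1 - \<i> * of_real (h \<bullet> lattice_vec \<eta>))
          \<le> (norm h)\<^sup>2 * bracket \<eta> ^ 2"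
        using norm_exp_i_minus_linear_le[of "h \<bullet> lattice_vec \<eta>"] by (simp add: power_mult_distrib)
      then have "norm (?r \<eta>) \<le> norm (c \<eta>) * ((norm h)\<^sup>2 * bracket \<eta> ^ 2)"
        unfolding norm_mult norm_character by (intro mult_mono) auto
      then show ?thesis by (simp add: mult_ac)
    qed
    have S: "(\<lambda>\<eta>. (norm h)\<^sup>2 * (norm (c \<eta>) * bracket \<eta> ^ 2)) summable_on UNIV"
      by (intro summable_on_cmult_right rapidly_decaying_summable assms)
    have ab: "(\<lambda>\<eta>. norm (?r \<eta>)) summable_on UNIV"
      by (rule summable_on_comparison_test[OF S]) (auto simp only: rle norm_ge_zero)
    have "norm (infsum ?r UNIV) \<le> (\<Sum>\<^sub>\<infinity>\<eta>. norm (?r \<eta>))"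
      by (rule norm_infsum_bound[OF ab])
    also have "\<dots> \<le> (\<Sum>\<^sub>\<infinity>\<eta>. (norm h)\<^sup>2 * (norm (c \<eta>) * bracket \<eta> ^ 2))"
      by (rule infsum_mono[OF ab S rle])
    also have "\<dots> = K * (norm h)\<^sup>2"
      unfolding K_def by (simp only: infsum_cmult_right' mult.commute)
    finally show ?thesis unfolding eq .
  qed
  show "(\<lambda>h. norm (fourier_series c (x + h) - fourier_series c x - ?D h) / norm h) \<midarrow>0\<rightarrow> 0"
  proof (rule tendsto_sandwich)
    show "((\<lambda>h :: real^'n. 0 :: real) \<longlongrightarrow> 0) (at 0)" by simp
    show "((\<lambda>h :: real^'n. K * norm h) \<longlongrightarrow> 0) (at 0)"
      by (auto intro!: tendsto_eq_intros)
    show "\<forall>\<^sub>F h in at 0. norm (fourier_series c (x + h) - fourier_series c x - ?D h) / norm h \<le> K * norm h"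
    proof (rule eventuallyI)
      fix h :: "real^'n"
      show "norm (fourier_series c (x + h) - fourier_series c x - ?D h) / norm h \<le> K * norm h"
        using bound[of h] by (cases "h = 0") (auto simp: divide_le_eq power2_eq_square mult_ac)
    qed
  qed auto
qed

lemma partial_deriv_fourier_series:
  assumes "rapidly_decaying c"
  shows "partial_deriv i (fourier_series c) = fourier_series (\<lambda>\<eta>. \<i> * of_int (\<eta> $ i) * c \<eta>)"
proof
  fix x
  have "(\<Sum>j\<in>UNIV. of_real (axis i 1 $ j) * fourier_series (\<lambda>\<eta>. \<i> * of_int (\<eta> $ j) * c \<eta>) x)
      = (\<Sum>j\<in>UNIV. if j = i then fourier_series (\<lambda>\<eta>. \<i> * of_int (\<eta> $ j) * c \<eta>) x else 0)"
    by (intro sum.cong) (auto simp: axis_def)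
  then show "partial_deriv i (fourier_series c) x = fourier_series (\<lambda>\<eta>. \<i> * of_int (\<eta> $ i) * c \<eta>) x"
    unfolding partial_deriv_def frechet_derivative_at[OF fourier_series_has_derivative[OF assms], symmetric]
    by simp
qed

lemma poly_bounded_monomial: "poly_bounded (\<lambda>\<eta>. \<Prod>i\<leftarrow>is. \<i> * of_int (\<eta> $ i))"
  by (induction "is") (auto intro: poly_bounded_const poly_bounded_mult poly_bounded_component)

lemma norm_monomial_le: "norm (\<Prod>i\<leftarrow>is. \<i> * of_int (\<eta> $ i) :: complex) \<le> bracket \<eta> ^ length is"
proof (induction "is")
  case (Cons i "is")
  then show ?case using abs_component_le_bracket[of \<eta> i] bracket_pos[of \<eta>]
    by (auto simp: norm_mult intro!: mult_mono)
qed simp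

lemma partial_derivs_fourier_series:
  assumes "rapidly_decaying c"
  shows "partial_derivs is (fourier_series c) = fourier_series (\<lambda>\<eta>. (\<Prod>i\<leftarrow>is. \<i> * of_int (\<eta> $ i)) * c \<eta>)"
  using assms
proof (induction "is" arbitrary: c)
  case (Cons i "is")
  have "partial_derivs (i # is) (fourier_series c) =
      partial_derivs is (fourier_series (\<lambda>\<eta>. \<i> * of_int (\<eta> $ i) * c \<eta>))"
    by (simp add: partial_derivs_def partial_deriv_fourier_series[OF Cons.prems])
  also have "\<dots> = fourier_series (\<lambda>\<eta>. (\<Prod>i\<leftarrow>is. \<i> * of_int (\<eta> $ i)) * (\<i> * of_int (\<eta> $ i) * c \<eta>))"
    by (intro Cons.IH rapidly_decaying_mult Cons.prems poly_bounded_component)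
  finally show ?case by (simp add: mult_ac)
qed (simp add: partial_derivs_def)

lemma fourier_series_smooth:
  assumes "rapidly_decaying c"
  shows "fourier_series c \<in> torus_smooth"
proof -
  have "partial_derivs is (fourier_series c) differentiable (at x)" for "is" x
    unfolding partial_derivs_fourier_series[OF assms] differentiable_def
    using fourier_series_has_derivative[OF rapidly_decaying_mult[OF assms poly_bounded_monomial]] by blast
  then show ?thesis by (simp add: torus_smooth_def fourier_series_def character_periodic)
qed

text \<open>Applied to the tail of a series, this makes the remainder small in every norm in which a
  distribution may be continuous.\<close>

lemma Ck_norm_fourier_series_le:
  assumes "rapidly_decaying c"
  shows "Ck_norm k (fourier_series c) \<le> (\<Sum>\<^sub>\<infinity>\<eta>. norm (c \<eta>) * bracket \<eta> ^ k)"
  unfolding Ck_norm_def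
proof (rule cSUP_least)
  show "{is. length is \<le> k} \<times> UNIV \<noteq> {}" by (auto intro: exI[of _ "[]"])
  fix p assume "p \<in> {is :: 'a list. length is \<le> k} \<times> (UNIV :: (real^'a) set)"
  then obtain "is" :: "'a list" and x :: "real^'a" where p: "p = (is, x)" "length is \<le> k" by auto
  let ?d = "\<lambda>\<eta>. (\<Prod>i\<leftarrow>is. \<i> * of_int (\<eta> $ i)) * c \<eta>"
  have d: "rapidly_decaying ?d"
    by (intro rapidly_decaying_mult assms poly_bounded_monomial)
  have "norm (fourier_series ?d x) \<le> (\<Sum>\<^sub>\<infinity>\<eta>. norm (?d \<eta>))"
    by (intro norm_fourier_series_le rapidly_decaying_summable_norm d)
  also have "\<dots> \<le> (\<Sum>\<^sub>\<infinity>\<eta>. norm (c \<eta>) * bracket \<eta> ^ k)"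
  proof (intro infsum_mono rapidly_decaying_summable_norm d rapidly_decaying_summable assms)
    fix \<eta>
    have "norm (\<Prod>i\<leftarrow>is. \<i> * of_int (\<eta> $ i) :: complex) \<le> bracket \<eta> ^ k"
      using p(2) by (rule order_trans[OF norm_monomial_le bracket_power_mono])
    then show "norm (?d \<eta>) \<le> norm (c \<eta>) * bracket \<eta> ^ k"
      unfolding norm_mult by (subst mult.commute) (rule mult_left_mono; simp)
  qed
  finally show "(case p of (is, x) \<Rightarrow> norm (partial_derivs is (fourier_series c) x)) \<le> \<dots>"
    by (simp add: p partial_derivs_fourier_series[OF assms])
qed

section \<open>Integration over the torus\<close>

abbreviation torus_box :: "(real^'n::finite) set" where
  "torus_box \<equiv> cbox 0 (\<chi> i. 2 * pi)"

definition torus_periodic :: "(real^'n::finite \<Rightarrow> 'a) \<Rightarrow> bool" where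
  "torus_periodic f \<longleftrightarrow> (\<forall>i x. f (x + axis i (2 * pi)) = f x)"

lemma axis_eq_scaleR: "axis i (t :: real) = t *\<^sub>R axis i 1"
  by (simp add: axis_def vec_eq_iff)

lemma torus_periodic_axis:
  assumes "torus_periodic f"
  shows "f (x + axis i (2 * pi * of_int n)) = f x"
proof -
  have shift: "f (x + axis i (2 * pi * of_int (n + 1))) = f (x + axis i (2 * pi * of_int n))" for n
  proof -
    have "x + axis i (2 * pi * of_int (n + 1)) = (x + axis i (2 * pi * of_int n)) + axis i (2 * pi)"
      by (simp add: axis_def vec_eq_iff algebra_simps)
    then show ?thesis using assms unfolding torus_periodic_def by metis
  qed
  show ?thesis
  proof (induction n rule: int_induct[where k = 0])
    case base
    then show ?case by (simp add: axis_eq_scaleR[of i 0])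
  next
    case (step1 n)
    then show ?case using shift[of n] by simp
  next
    case (step2 n)
    then show ?case using shift[of "n - 1"] by simp
  qed
qed

lemma torus_periodic_eq:
  fixes x y :: "real^'n::finite"
  assumes "torus_periodic f" "\<And>i. \<exists>n::int. y $ i = x $ i + 2 * pi * of_int n"
  shows "f y = f x"
proof -
  obtain n :: "'n \<Rightarrow> int" where n: "y $ i = x $ i + 2 * pi * of_int (n i)" for i
    using assms(2) by metis
  have *: "f (x + (\<Sum>i\<in>I. axis i (2 * pi * of_int (n i)))) = f x" for I
  proof (induction I rule: infinite_finite_induct)
    case (insert i I)
    then show ?case
      using torus_periodic_axis[OF assms(1), of "x + (\<Sum>i\<in>I. axis i (2 * pi * of_int (n i)))" i "n i"]
      by (simp add: add_ac)
  qed auto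
  have "(\<Sum>i\<in>UNIV. axis i (2 * pi * real_of_int (n i))) $ j = 2 * pi * of_int (n j)" for j
  proof -
    have "(\<Sum>i\<in>UNIV. axis i (2 * pi * real_of_int (n i))) $ j
        = (\<Sum>i\<in>UNIV. if i = j then 2 * pi * of_int (n i) else 0)"
      unfolding sum_component by (intro sum.cong) (auto simp: axis_def)
    then show ?thesis by simp
  qed
  then have "y = x + (\<Sum>i\<in>UNIV. axis i (2 * pi * of_int (n i)))"
    by (simp add: vec_eq_iff n)
  then show ?thesis using *[of UNIV] by simp
qed

lemma torus_periodic_reduce:
  fixes x :: "real^'n::finite"
  assumes "torus_periodic f"
  obtains y where "y \<in> torus_box" "f x = f y"
proof
  define y :: "real^'n" where "y = (\<chi> i. x $ i - 2 * pi * of_int \<lfloor>x $ i / (2 * pi)\<rfloor>)"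
  show "y \<in> torus_box"
    unfolding mem_box_cart
  proof
    fix i
    have "of_int \<lfloor>x $ i / (2 * pi)\<rfloor> \<le> x $ i / (2 * pi)" "x $ i / (2 * pi) \<le> of_int \<lfloor>x $ i / (2 * pi)\<rfloor> + 1"
      by linarith+
    then have "2 * pi * of_int \<lfloor>x $ i / (2 * pi)\<rfloor> \<le> 2 * pi * (x $ i / (2 * pi))"
      "2 * pi * (x $ i / (2 * pi)) \<le> 2 * pi * (of_int \<lfloor>x $ i / (2 * pi)\<rfloor> + 1)"
      by (intro mult_left_mono; simp)+
    then show "0 $ i \<le> y $ i \<and> y $ i \<le> (\<chi> i. 2 * pi) $ i"
      by (simp add: y_def distrib_left)
  qed
  have "\<exists>n::int. x $ i = y $ i + 2 * pi * of_int n" for i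
    by (intro exI[of _ "\<lfloor>x $ i / (2 * pi)\<rfloor>"]) (simp add: y_def)
  then show "f x = f y" by (rule torus_periodic_eq[OF assms])
qed

section \<open>Derivatives of smooth periodic functions and their suprema\<close>

lemma torus_smooth_periodic: "f \<in> torus_smooth \<Longrightarrow> torus_periodic f"
  by (simp add: torus_smooth_def torus_periodic_def)

lemma torus_smooth_differentiable: "f \<in> torus_smooth \<Longrightarrow> f differentiable (at x)"
  unfolding torus_smooth_def partial_derivs_def by (auto dest!: spec[of _ "[]"])

lemma torus_smooth_continuous: "f \<in> torus_smooth \<Longrightarrow> continuous_on S f"
  by (intro continuous_at_imp_continuous_on ballI differentiable_imp_continuous_within
      torus_smooth_differentiable)

lemma torus_smooth_has_derivative:
  "f \<in> torus_smooth \<Longrightarrow> (f has_derivative frechet_derivative f (at x)) (at x)"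
  by (rule frechet_derivative_works[THEN iffD1, OF torus_smooth_differentiable])

text \<open>Translation by a period leaves \<open>f\<close> unchanged, so uniqueness of the
  derivative identifies \<open>D (x + p)\<close> with \<open>D x\<close>.\<close>

lemma has_derivative_periodic:
  fixes f :: "real^'n::finite \<Rightarrow> 'b::real_normed_vector"
  assumes "torus_periodic f" "\<And>x. (f has_derivative D x) (at x)"
  shows "torus_periodic D"
  unfolding torus_periodic_def
proof (intro allI)
  fix i x
  let ?p = "axis i (2 * pi) :: real^'n"
  have "((\<lambda>x. f (x + ?p)) has_derivative D (x + ?p)) (at x)"
    using has_derivative_compose[OF has_derivative_add_const[OF has_derivative_ident] assms(2), of ?p x UNIV]
    by (simp add: has_derivative_add_const)
  moreover have "(\<lambda>x. f (x + ?p)) = f" using assms(1) by (auto simp: torus_periodic_def)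
  ultimately show "D (x + ?p) = D x" using assms(2) has_derivative_unique by metis
qed

lemma torus_smooth_partial_deriv:
  assumes "f \<in> torus_smooth"
  shows "partial_deriv i f \<in> torus_smooth"
proof -
  have "partial_derivs is (partial_deriv i f) differentiable (at x)" for "is" x
    using assms unfolding torus_smooth_def partial_derivs_def by (auto dest!: spec[of _ "i # is"])
  moreover have "torus_periodic (\<lambda>x. frechet_derivative f (at x))"
    by (rule has_derivative_periodic[OF torus_smooth_periodic torus_smooth_has_derivative])
      (use assms in auto)
  ultimately show ?thesis by (simp add: torus_smooth_def torus_periodic_def partial_deriv_def)
qed

lemma torus_smooth_partial_derivs:
  "f \<in> torus_smooth \<Longrightarrow> partial_derivs is f \<in> torus_smooth"
  by (induction "is" arbitrary: f) (auto simp: partial_derivs_def torus_smooth_partial_deriv)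

lemma torus_periodic_bounded:
  fixes f :: "real^'n::finite \<Rightarrow> 'a::real_normed_vector"
  assumes "torus_periodic f" "continuous_on UNIV f"
  shows "\<exists>B. \<forall>x. norm (f x) \<le> B"
proof -
  have "compact (f ` torus_box)"
    by (intro compact_continuous_image continuous_on_subset[OF assms(2)]) auto
  from compact_imp_bounded[OF this] obtain B where B: "\<forall>y\<in>f ` torus_box. norm y \<le> B"
    unfolding bounded_iff ..
  have "norm (f x) \<le> B" for x
  proof -
    obtain y where "y \<in> torus_box" "f x = f y" by (rule torus_periodic_reduce[OF assms(1)])
    then show ?thesis using B by simp
  qed
  then show ?thesis by blast
qed

text \<open>A supremum dominates its members only if the set is bounded above. Each derivative is
  continuous and periodic, hence bounded by compactness of the period box, and only finitely many
  index lists have length at most \<open>k\<close>.\<close>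

lemma norm_partial_derivs_le_Ck_norm:
  fixes f :: "real^'n::finite \<Rightarrow> complex"
  assumes "f \<in> torus_smooth" "length is \<le> k"
  shows "norm (partial_derivs is f x) \<le> Ck_norm k f"
proof -
  have "\<exists>B. \<forall>x. norm (partial_derivs js f x) \<le> B" for js
    by (intro torus_periodic_bounded torus_smooth_continuous torus_smooth_periodic
        torus_smooth_partial_derivs assms)
  then obtain B where B: "norm (partial_derivs js f x) \<le> B js" for js x by metis
  have fin: "finite {js :: 'n list. length js \<le> k}"
    using finite_lists_length_le[of "UNIV :: 'n set" k] by simp
  have "bdd_above ((\<lambda>(js, x). norm (partial_derivs js f x)) ` ({js. length js \<le> k} \<times> UNIV))"
  proof (rule bdd_aboveI2)
    fix p assume "p \<in> {js :: 'n list. length js \<le> k} \<times> (UNIV :: (real^'n) set)"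
    then obtain js y where p: "p = (js, y)" "length js \<le> k" by blast
    have "B js \<le> Max (B ` {js. length js \<le> k})"
      using fin p(2) by (intro Max_ge) auto
    then show "(case p of (js, x) \<Rightarrow> norm (partial_derivs js f x)) \<le> Max (B ` {js. length js \<le> k})"
      using B[of js y] by (simp add: p(1))
  qed
  moreover have "(is, x) \<in> {js. length js \<le> k} \<times> UNIV" using assms(2) by simp
  ultimately have "(\<lambda>(js, x). norm (partial_derivs js f x)) (is, x) \<le> Ck_norm k f"
    unfolding Ck_norm_def by (rule cSUP_upper[rotated])
  then show ?thesis by simp
qed

lemma norm_le_Ck_norm: "f \<in> torus_smooth \<Longrightarrow> norm (f x) \<le> Ck_norm k f"
  using norm_partial_derivs_le_Ck_norm[of f "[]" k x] by (simp add: partial_derivs_def)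

lemma Ck_norm_nonneg: "f \<in> torus_smooth \<Longrightarrow> 0 \<le> Ck_norm k f"
  by (rule order_trans[OF norm_ge_zero norm_le_Ck_norm])

section \<open>Integrals of continuous periodic functions\<close>

lemma continuous_torus_integrable:
  fixes f :: "real^'n::finite \<Rightarrow> 'b::banach"
  shows "continuous_on UNIV f \<Longrightarrow> f integrable_on torus_box"
  by (rule integrable_continuous) (erule continuous_on_subset, simp)

lemma content_torus_box: "measure lborel (torus_box :: (real^'n::finite) set) = (2 * pi) ^ CARD('n)"
proof -
  have "0 \<in> (torus_box :: (real^'n) set)" by (simp add: mem_box_cart)
  then have "torus_box \<noteq> ({} :: (real^'n) set)" by blast
  then show ?thesis by (simp add: content_cbox_cart)
qed

lemma norm_torus_integral_le:
  fixes f :: "real^'n::finite \<Rightarrow> complex"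
  assumes "continuous_on UNIV f" "\<And>x. x \<in> torus_box \<Longrightarrow> norm (f x) \<le> B"
  shows "norm (torus_integral f) \<le> B * (2 * pi) ^ CARD('n)"
proof -
  have "0 \<le> B" by (rule order_trans[OF norm_ge_zero assms(2)[of 0]]) (simp add: mem_box_cart)
  moreover have "(f has_integral torus_integral f) torus_box"
    unfolding torus_integral_def by (intro integrable_integral continuous_torus_integrable assms)
  ultimately show ?thesis
    using has_integral_bound[of B f "torus_integral f" 0 "\<chi> i. 2 * pi"] assms(2)
    by (simp add: content_torus_box)
qed

text \<open>The box is cut at the hyperplane where the i-th coordinate is 2 pi - t. Translation
  moves the lower piece to the coordinates from t to 2 pi; the upper piece leaves the box and is
  brought back by one period to the coordinates from 0 to t. The two images again fill the
  box.\<close>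

lemma torus_integral_shift:
  fixes g :: "real^'n::finite \<Rightarrow> complex"
  assumes "continuous_on UNIV g" "torus_periodic g" "0 \<le> t" "t \<le> 2 * pi"
  shows "torus_integral (\<lambda>x. g (x + axis i t)) = torus_integral g"
proof -
  define b :: "real^'n" where "b = (\<chi> i. 2 * pi)"
  let ?G = "\<lambda>x. g (x + axis i t)"
  have int: "f integrable_on cbox u v" if "continuous_on UNIV f" for f :: "real^'n \<Rightarrow> complex" and u v
    by (rule integrable_continuous, rule continuous_on_subset[OF that]) auto
  have contG: "continuous_on UNIV ?G"
    by (intro continuous_on_compose2[OF assms(1)] continuous_intros) auto
  have split: "integral (cbox 0 b) f = integral (cbox 0 (b - axis i (2 * pi - c))) f + integral (cbox (axis i c) b) f"
    if "continuous_on UNIV f" "0 \<le> c" "c \<le> 2 * pi" for f :: "real^'n \<Rightarrow> complex" and c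
  proof -
    have i: "x \<bullet> axis i 1 = x $ i" for x :: "real^'n" by (simp add: inner_axis)
    have lower: "x \<in> cbox 0 (b - axis i (2 * pi - c)) \<longleftrightarrow> (\<forall>j. 0 \<le> x $ j \<and> x $ j \<le> (if j = i then c else 2 * pi))"
      for x by (simp add: mem_box_cart b_def axis_def)
    have upper: "x \<in> cbox (axis i c) b \<longleftrightarrow> (\<forall>j. (if j = i then c else 0) \<le> x $ j \<and> x $ j \<le> 2 * pi)" for x
      by (simp add: mem_box_cart b_def axis_def)
    have all: "x \<in> cbox 0 b \<longleftrightarrow> (\<forall>j. 0 \<le> x $ j \<and> x $ j \<le> 2 * pi)" for x
      by (simp add: mem_box_cart b_def)
    have "cbox 0 b \<inter> {x. x \<bullet> axis i 1 \<le> c} = cbox 0 (b - axis i (2 * pi - c))"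
      using that(2,3) by (auto simp: lower all i; smt (verit))
    moreover have "cbox 0 b \<inter> {x. x \<bullet> axis i 1 \<ge> c} = cbox (axis i c) b"
      using that(2,3) by (auto simp: upper all i; smt (verit))
    ultimately show ?thesis
      using integral_split[OF int[OF that(1)], of "axis i 1" 0 b c] by (simp add: axis_in_Basis_iff)
  qed
  have "integral (cbox 0 b) ?G = integral (cbox 0 (b - axis i t)) ?G + integral (cbox (axis i (2 * pi - t)) b) ?G"
    using split[OF contG, of "2 * pi - t"] assms(3,4) by simp
  also have "integral (cbox 0 (b - axis i t)) ?G = integral (cbox (axis i t) b) g"
    using integral_shift_cbox_plus[of 0 "b - axis i t" g "axis i t"] by (simp add: o_def add.commute)
  also have "integral (cbox (axis i (2 * pi - t)) b) ?G = integral (cbox 0 (b - axis i (2 * pi - t))) g"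
  proof -
    \<comment> \<open>By periodicity the shift by t may be replaced by the shift by t - 2 pi, which
      carries the upper slab to the bottom of the box.\<close>
    have "?G x = g (axis i (t - 2 * pi) + x)" for x
    proof -
      have "x + axis i t = (axis i (t - 2 * pi) + x) + axis i (2 * pi)"
        by (simp add: axis_def vec_eq_iff)
      then show ?thesis using assms(2) unfolding torus_periodic_def by metis
    qed
    moreover have "axis i (2 * pi - t) + axis i (t - 2 * pi) = (0 :: real^'n)"
      "b + axis i (t - 2 * pi) = b - axis i (2 * pi - t)"
      by (simp_all add: axis_def vec_eq_iff)
    ultimately show ?thesis
      using integral_shift_cbox_plus[of "axis i (2 * pi - t)" b g "axis i (t - 2 * pi)"] by (simp add: o_def)
  qed
  also have "integral (cbox (axis i t) b) g + integral (cbox 0 (b - axis i (2 * pi - t))) g = integral (cbox 0 b) g"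
    using split[OF assms(1,3,4)] by simp
  finally show ?thesis by (simp add: torus_integral_def b_def)
qed

text \<open>Averaging over translations in the direction \<open>i\<close> reduces the claim to the
  one-dimensional fundamental theorem of calculus.\<close>

lemma torus_integral_derivative:
  fixes f :: "real^'n::finite \<Rightarrow> complex"
  assumes f: "torus_periodic f" "\<And>x. (f has_derivative D x) (at x)"
    and cont: "continuous_on UNIV (\<lambda>x. D x (axis i 1))"
  shows "torus_integral (\<lambda>x. D x (axis i 1)) = 0"
proof -
  define g where "g x = D x (axis i 1)" for x
  define e :: "real^'n" where "e = axis i 1"
  have e: "axis i t = t *\<^sub>R e" for t by (simp add: e_def axis_def vec_eq_iff)
  have contg: "continuous_on UNIV g" unfolding g_def by (rule cont)
  have perg: "torus_periodic g"
    using has_derivative_periodic[OF f] by (simp add: torus_periodic_def g_def)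
  \<comment> \<open>Along a full period in direction \<open>i\<close>, the fundamental theorem gives
    the difference of two equal values of \<open>f\<close>.\<close>
  have inner: "integral {0..2 * pi} (\<lambda>t. g (x + axis i t)) = 0" for x
  proof -
    have "((\<lambda>t. f (x + axis i t)) has_vector_derivative g (x + axis i t)) (at t within {0..2 * pi})" for t
    proof -
      have "((\<lambda>t. x + axis i t) has_derivative (\<lambda>h. axis i h)) (at t within {0..2 * pi})"
        unfolding e by (auto intro!: derivative_eq_intros)
      from has_derivative_compose[OF this f(2)]
      have "((\<lambda>t. f (x + axis i t)) has_derivative (\<lambda>h. D (x + axis i t) (axis i h))) (at t within {0..2 * pi})" .
      moreover have "D (x + axis i t) (axis i h) = h *\<^sub>R g (x + axis i t)" for h
        using has_derivative_linear[OF f(2)] by (simp add: g_def e linear_cmul)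
      ultimately show ?thesis by (simp add: has_vector_derivative_def)
    qed
    then have "((\<lambda>t. g (x + axis i t)) has_integral (f (x + axis i (2 * pi)) - f (x + axis i 0))) {0..2 * pi}"
      by (intro fundamental_theorem_of_calculus) auto
    moreover have "f (x + axis i (2 * pi)) - f (x + axis i 0) = 0"
      using f(1) by (simp add: torus_periodic_def e[of 0])
    ultimately show ?thesis by (simp add: integral_unique)
  qed
  have "continuous_on (cbox (0, 0) (2 * pi, \<chi> i. 2 * pi)) (\<lambda>(t, x). g (x + axis i t))"
    unfolding case_prod_unfold e
    by (intro continuous_on_compose2[OF contg] continuous_intros) auto
  then have "integral (cbox 0 (2 * pi)) (\<lambda>t. torus_integral (\<lambda>x. g (x + axis i t)))
      = torus_integral (\<lambda>x. integral (cbox 0 (2 * pi)) (\<lambda>t. g (x + axis i t)))"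
    unfolding torus_integral_def by (rule integral_swap_continuous)
  also have "\<dots> = 0" by (simp add: inner torus_integral_def)
  \<comment> \<open>Translation invariance makes the averaged integrand constant in
    \<open>t\<close>, so 2 pi times the wanted integral is zero.\<close>
  also have "integral (cbox 0 (2 * pi)) (\<lambda>t. torus_integral (\<lambda>x. g (x + axis i t)))
      = integral (cbox 0 (2 * pi)) (\<lambda>t. torus_integral g)"
    by (rule integral_cong) (auto intro: torus_integral_shift contg perg)
  finally show ?thesis by (simp add: g_def[abs_def])
qed

section \<open>Integrals against characters and their decay\<close>

lemma character_has_derivative:
  "(character \<eta> has_derivative (\<lambda>h. \<i> * of_real (h \<bullet> lattice_vec \<eta>) * character \<eta> x)) (at x)"
proof -
  have "((\<lambda>y. \<i> * complex_of_real (y \<bullet> lattice_vec \<eta>)) has_derivative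
      (\<lambda>h. \<i> * complex_of_real (h \<bullet> lattice_vec \<eta>))) (at x)"
    by (auto intro!: derivative_eq_intros)
  from has_derivative_compose[OF this DERIV_exp[unfolded has_field_derivative_def]]
  show ?thesis by (simp add: character_def mult.commute)
qed

lemma continuous_character: "continuous_on S (character \<eta>)"
  by (intro continuous_at_imp_continuous_on ballI has_derivative_continuous[OF character_has_derivative])

text \<open>For \<eta> \<noteq> 0 some coordinate of \<eta> is nonzero, and the character is then,
  up to the nonzero factor i times that coordinate, a partial derivative of itself; such integrals
  vanish.\<close>

lemma torus_integral_character:
  "torus_integral (character (\<eta> :: int^'n::finite)) = (if \<eta> = 0 then (2 * of_real pi) ^ CARD('n) else 0)"
proof (cases "\<eta> = 0")
  case True
  then have "character \<eta> = (\<lambda>_. 1)" by (simp add: fun_eq_iff character_0)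
  then show ?thesis using True
    by (simp add: torus_integral_def content_torus_box scaleR_conv_of_real)
next
  case False
  then obtain i where i: "\<eta> $ i \<noteq> 0" by (auto simp: vec_eq_iff)
  have "torus_integral (\<lambda>x. \<i> * of_real (axis i 1 \<bullet> lattice_vec \<eta>) * character \<eta> x) = 0"
  proof (rule torus_integral_derivative[where f = "character \<eta>" and i = i
        and D = "\<lambda>x h. \<i> * of_real (h \<bullet> lattice_vec \<eta>) * character \<eta> x"])
    show "torus_periodic (character \<eta>)" by (simp add: torus_periodic_def character_periodic)
    show "continuous_on UNIV (\<lambda>x. \<i> * of_real (axis i 1 \<bullet> lattice_vec \<eta>) * character \<eta> x)"
      by (intro continuous_on_mult continuous_on_const continuous_character)
  qed (rule character_has_derivative)
  then show ?thesis using i False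
    by (simp add: torus_integral_def inner_axis' lattice_vec_def)
qed

text \<open>Integration by parts without boundary terms: the product of \<phi> with the character is
  periodic, so its partial derivative integrates to zero.\<close>

lemma torus_integral_partial_deriv_character:
  assumes "\<phi> \<in> torus_smooth"
  shows "torus_integral (\<lambda>x. partial_deriv i \<phi> x * character \<eta> x)
    = - (\<i> * of_int (\<eta> $ i)) * torus_integral (\<lambda>x. \<phi> x * character \<eta> x)"
proof -
  let ?D = "\<lambda>x h. \<phi> x * (\<i> * of_real (h \<bullet> lattice_vec \<eta>) * character \<eta> x)
    + frechet_derivative \<phi> (at x) h * character \<eta> x"
  have cont: "continuous_on UNIV \<phi>" by (rule torus_smooth_continuous[OF assms])
  have contd: "continuous_on UNIV (partial_deriv i \<phi>)"
    by (intro torus_smooth_continuous torus_smooth_partial_deriv assms)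
  have eq: "(\<lambda>x. ?D x (axis i 1)) = (\<lambda>x. (\<i> * of_int (\<eta> $ i)) * (\<phi> x * character \<eta> x)
      + partial_deriv i \<phi> x * character \<eta> x)"
    by (simp add: fun_eq_iff partial_deriv_def inner_axis' lattice_vec_def)
  have "torus_integral (\<lambda>x. ?D x (axis i 1)) = 0"
  proof (rule torus_integral_derivative[where D = ?D])
    show "torus_periodic (\<lambda>x. \<phi> x * character \<eta> x)"
      using torus_smooth_periodic[OF assms] by (simp add: torus_periodic_def character_periodic)
    show "((\<lambda>x. \<phi> x * character \<eta> x) has_derivative ?D x) (at x)" for x
      by (rule has_derivative_mult[OF torus_smooth_has_derivative[OF assms] character_has_derivative])
    show "continuous_on UNIV (\<lambda>x. ?D x (axis i 1))"
      unfolding eq by (intro continuous_intros contd continuous_character cont)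
  qed
  then have "0 = torus_integral (\<lambda>x. (\<i> * of_int (\<eta> $ i)) * (\<phi> x * character \<eta> x))
      + torus_integral (\<lambda>x. partial_deriv i \<phi> x * character \<eta> x)"
    unfolding eq torus_integral_def
    by (subst (asm) integral_add) (auto intro!: continuous_torus_integrable continuous_intros contd
        continuous_character cont)
  then show ?thesis
    by (simp add: torus_integral_def eq_neg_iff_add_eq_0 add.commute)
qed

lemma torus_integral_partial_derivs_character:
  assumes "\<phi> \<in> torus_smooth"
  shows "torus_integral (\<lambda>x. partial_derivs (replicate k i) \<phi> x * character \<eta> x)
    = (- (\<i> * of_int (\<eta> $ i))) ^ k * torus_integral (\<lambda>x. \<phi> x * character \<eta> x)"
  using assms
proof (induction k arbitrary: \<phi>)
  case (Suc k)
  then show ?case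
    using torus_smooth_partial_deriv[OF Suc.prems, of i]
    by (simp add: partial_derivs_def torus_integral_partial_deriv_character)
qed (simp add: partial_derivs_def)

text \<open>Take the coordinate of largest modulus m. The Euclidean norm is at most the sum of the
  moduli, hence at most N m, and the summand 1 in the bracket is absorbed because m is at least 1
  for a nonzero integer vector.\<close>

lemma bracket_le_component:
  fixes \<eta> :: "int^'n::finite"
  assumes "\<eta> \<noteq> 0"
  obtains i where "bracket \<eta> \<le> (1 + CARD('n)) * \<bar>real_of_int (\<eta> $ i)\<bar>"
proof -
  define m where "m = Max (range (\<lambda>i. \<bar>real_of_int (\<eta> $ i)\<bar>))"
  have "m \<in> range (\<lambda>i. \<bar>real_of_int (\<eta> $ i)\<bar>)" unfolding m_def by (intro Max_in) auto
  then obtain i where i: "m = \<bar>real_of_int (\<eta> $ i)\<bar>" by blast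
  have le: "\<bar>real_of_int (\<eta> $ j)\<bar> \<le> m" for j unfolding m_def by (intro Max_ge) auto
  obtain j where "\<eta> $ j \<noteq> 0" using assms by (auto simp: vec_eq_iff)
  then have "1 \<le> m" using le[of j] by linarith
  moreover have "norm (lattice_vec \<eta>) \<le> (\<Sum>j\<in>UNIV. \<bar>lattice_vec \<eta> $ j\<bar>)" by (rule norm_le_l1_cart)
  moreover have "\<dots> \<le> (\<Sum>j\<in>(UNIV :: 'n set). m)"
    by (intro sum_mono) (simp add: lattice_vec_def le)
  ultimately have "bracket \<eta> \<le> (1 + CARD('n)) * m" by (simp add: bracket_def distrib_right)
  then show ?thesis using that i by blast
qed

text \<open>Integrating by parts k times in the direction of the largest coordinate of \<eta> gains
  k powers of the bracket. The dependence on \<phi> is kept explicit because the same bound later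
  yields continuity of functionals.\<close>

lemma torus_integral_character_decay:
  fixes \<phi> :: "real^'n::finite \<Rightarrow> complex"
  assumes "\<phi> \<in> torus_smooth"
  shows "norm (torus_integral (\<lambda>x. \<phi> x * character \<eta> x)) * bracket \<eta> ^ k
    \<le> ((1 + CARD('n)) ^ k * (2 * pi) ^ CARD('n)) * Ck_norm k \<phi>"
proof -
  have bound: "norm (torus_integral (\<lambda>x. partial_derivs is \<phi> x * character \<eta> x)) \<le> Ck_norm k \<phi> * (2 * pi) ^ CARD('n)"
    if "length is \<le> k" for "is"
  proof (rule norm_torus_integral_le)
    show "continuous_on UNIV (\<lambda>x. partial_derivs is \<phi> x * character \<eta> x)"
      by (intro continuous_on_mult continuous_character torus_smooth_continuous[OF torus_smooth_partial_derivs] assms)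
    show "norm (partial_derivs is \<phi> x * character \<eta> x) \<le> Ck_norm k \<phi>" for x
      using norm_partial_derivs_le_Ck_norm[OF assms that] by (simp add: norm_mult norm_character)
  qed
  show ?thesis
  proof (cases "\<eta> = 0")
    case True
    \<comment> \<open>At the origin there is no direction in which to integrate by parts, but the
      weight is 1 and the trivial bound suffices.\<close>
    have "bracket (0 :: int^'n) = 1"
      by (simp add: bracket_def lattice_vec_def vec_eq_iff)
    moreover have "1 * (Ck_norm k \<phi> * (2 * pi) ^ CARD('n)) \<le> real (1 + CARD('n)) ^ k * (Ck_norm k \<phi> * (2 * pi) ^ CARD('n))"
      by (intro mult_right_mono one_le_power) (auto simp: Ck_norm_nonneg assms)
    ultimately show ?thesis
      using bound[of "[]"] True by (simp add: partial_derivs_def mult_ac)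
  next
    case False
    then obtain i where i: "bracket \<eta> \<le> (1 + CARD('n)) * \<bar>real_of_int (\<eta> $ i)\<bar>"
      by (rule bracket_le_component)
    have "norm (torus_integral (\<lambda>x. \<phi> x * character \<eta> x)) * bracket \<eta> ^ k
        \<le> norm (torus_integral (\<lambda>x. \<phi> x * character \<eta> x)) * ((1 + CARD('n)) * \<bar>real_of_int (\<eta> $ i)\<bar>) ^ k"
      using bracket_pos[of \<eta>] by (intro mult_left_mono power_mono i) auto
    also have "\<dots> = (1 + CARD('n)) ^ k * norm (torus_integral (\<lambda>x. partial_derivs (replicate k i) \<phi> x * character \<eta> x))"
      unfolding torus_integral_partial_derivs_character[OF assms]
      by (simp add: norm_mult norm_power power_mult_distrib)
    also have "\<dots> \<le> (1 + CARD('n)) ^ k * (Ck_norm k \<phi> * (2 * pi) ^ CARD('n))"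
      by (intro mult_left_mono bound) auto
    finally show ?thesis by (simp add: mult_ac)
  qed
qed

section \<open>Completeness of the characters and Fourier inversion\<close>

inductive trig_poly :: "(real^'n::finite \<Rightarrow> complex) \<Rightarrow> bool" where
  monomial: "trig_poly (\<lambda>x. c * character \<eta> x)"
| add: "trig_poly f \<Longrightarrow> trig_poly g \<Longrightarrow> trig_poly (\<lambda>x. f x + g x)"

lemma trig_poly_const: "trig_poly (\<lambda>x. c)"
  using trig_poly.monomial[of c 0] by (simp add: character_0)

lemma trig_poly_mult:
  assumes "trig_poly f" "trig_poly g"
  shows "trig_poly (\<lambda>x. f x * g x)"
  using assms(1)
proof induction
  case (monomial c \<eta>)
  show ?case using assms(2)
  proof induction
    case (monomial d \<xi>)
    have "(\<lambda>x. c * character \<eta> x * (d * character \<xi> x)) = (\<lambda>x. (c * d) * character (\<eta> + \<xi>) x)"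
      by (simp add: fun_eq_iff character_add)
    then show ?case using trig_poly.monomial by metis
  next
    case (add f g)
    then show ?case using trig_poly.add by (simp add: distrib_left)
  qed
next
  case (add f g)
  then show ?case using trig_poly.add by (simp add: distrib_right)
qed

lemma trig_poly_sum:
  "(\<And>i. i \<in> I \<Longrightarrow> trig_poly (f i)) \<Longrightarrow> trig_poly (\<lambda>x. \<Sum>i\<in>I. f i x)"
  by (induction I rule: infinite_finite_induct) (auto intro: trig_poly_const trig_poly.add)

lemma trig_poly_continuous: "trig_poly t \<Longrightarrow> continuous_on S t"
  by (induction rule: trig_poly.induct) (auto intro!: continuous_intros continuous_character)

lemma torus_integral_add:
  "continuous_on UNIV f \<Longrightarrow> continuous_on UNIV g \<Longrightarrow>
    torus_integral (\<lambda>x. f x + g x) = torus_integral f + torus_integral g"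
  unfolding torus_integral_def by (intro integral_add continuous_torus_integrable)

lemma torus_integral_diff:
  "continuous_on UNIV f \<Longrightarrow> continuous_on UNIV g \<Longrightarrow>
    torus_integral (\<lambda>x. f x - g x) = torus_integral f - torus_integral g"
  unfolding torus_integral_def by (intro integral_diff continuous_torus_integrable)

lemma torus_integral_cmult: "torus_integral (\<lambda>x. c * f x) = c * torus_integral f"
  unfolding torus_integral_def by simp

section \<open>Density of trigonometric polynomials\<close>

definition torus_embedding :: "real^'n::finite \<Rightarrow> complex^'n" where
  "torus_embedding x = (\<chi> i. exp (\<i> * complex_of_real (x $ i)))"

lemma torus_embedding_character: "torus_embedding x $ i = character (axis i 1) x"
proof -
  have "lattice_vec (axis i 1) = axis i 1"
    by (simp add: lattice_vec_def axis_def vec_eq_iff)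
  then show ?thesis by (simp add: torus_embedding_def character_def inner_axis)
qed

lemma cnj_character: "cnj (character \<eta> x) = character (- \<eta>) x"
  by (simp add: character_def lattice_vec_uminus exp_cnj)

lemma continuous_torus_embedding: "continuous_on S torus_embedding"
  unfolding torus_embedding_def by (intro continuous_intros)

lemma torus_embedding_eq:
  assumes "torus_periodic f" "torus_embedding x = torus_embedding y"
  shows "f x = f y"
proof (rule torus_periodic_eq[OF assms(1)])
  fix i
  have "exp (\<i> * complex_of_real (x $ i)) = exp (\<i> * complex_of_real (y $ i))"
    using assms(2) by (simp add: torus_embedding_def vec_eq_iff)
  then obtain n :: int where "\<i> * complex_of_real (x $ i) = \<i> * complex_of_real (y $ i) + (of_int (2 * n) * pi) * \<i>"
    unfolding exp_eq by blast
  then have "x $ i = y $ i + 2 * pi * of_int n"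
    by (auto simp: complex_eq_iff)
  then show "\<exists>n::int. x $ i = y $ i + 2 * pi * of_int n" by blast
qed

text \<open>Real polynomial functions are generated by functionals that are only real-linear, so the
  expansion must use a real basis, with both 1 and \<i> on each axis.\<close>

lemma complex_vec_expansion:
  fixes v :: "complex^'n::finite"
  shows "v = (\<Sum>i\<in>UNIV. Re (v $ i) *\<^sub>R axis i 1 + Im (v $ i) *\<^sub>R axis i \<i>)"
  unfolding vec_eq_iff
proof
  fix j
  have "(\<Sum>i\<in>UNIV. Re (v $ i) *\<^sub>R axis i 1 + Im (v $ i) *\<^sub>R axis i \<i>) $ j
      = (\<Sum>i\<in>UNIV. if i = j then v $ i else 0)"
    unfolding sum_component
    by (intro sum.cong) (auto simp: axis_def complex_eq_iff)
  then show "v $ j = (\<Sum>i\<in>UNIV. Re (v $ i) *\<^sub>R axis i 1 + Im (v $ i) *\<^sub>R axis i \<i>) $ j" by simp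
qed

lemma trig_poly_Re_Im_embedding:
  "trig_poly (\<lambda>x. of_real (Re (torus_embedding x $ i)))"
  "trig_poly (\<lambda>x. of_real (Im (torus_embedding x $ i)))"
proof -
  have "of_real (Re (torus_embedding x $ i)) =
      1/2 * character (axis i 1) x + 1/2 * character (- axis i 1) x" for x
    using complex_add_cnj[of "character (axis i 1) x"]
    by (simp add: torus_embedding_character cnj_character field_simps)
  then show "trig_poly (\<lambda>x. of_real (Re (torus_embedding x $ i)))"
    by (simp only: trig_poly.intros)
  have "of_real (Im (torus_embedding x $ i)) =
      (- \<i>/2) * character (axis i 1) x + (\<i>/2) * character (- axis i 1) x" for x
  proof -
    have "of_real (Im z) = (- \<i>/2) * (z - cnj z)" for z
      by (simp add: complex_eq_iff)
    then show ?thesis by (simp add: torus_embedding_character cnj_character right_diff_distrib)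
  qed
  then show "trig_poly (\<lambda>x. of_real (Im (torus_embedding x $ i)))"
    by (simp only: trig_poly.intros)
qed

lemma trig_poly_real_polynomial:
  assumes "real_polynomial_function q"
  shows "trig_poly (\<lambda>x. of_real (q (torus_embedding x)))"
  using assms
proof induction
  case (linear q)
  interpret bounded_linear q by fact
  have "of_real (q (torus_embedding x)) = (\<Sum>i\<in>UNIV.
      of_real (q (axis i 1)) * of_real (Re (torus_embedding x $ i))
      + of_real (q (axis i \<i>)) * complex_of_real (Im (torus_embedding x $ i)))" for x
    by (subst complex_vec_expansion) (simp add: sum add scaleR mult.commute)
  then show ?case
    by (simp only:) (intro trig_poly_sum trig_poly.add trig_poly_mult trig_poly_const trig_poly_Re_Im_embedding)
qed (auto intro: trig_poly_const trig_poly.add trig_poly_mult)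

lemma trig_poly_polynomial:
  fixes p :: "complex^'n::finite \<Rightarrow> complex"
  assumes "polynomial_function p"
  shows "trig_poly (\<lambda>x. p (torus_embedding x))"
proof -
  have "real_polynomial_function (Re \<circ> p)" "real_polynomial_function (Im \<circ> p)"
    using assms bounded_linear_Re bounded_linear_Im unfolding polynomial_function_def by blast+
  from this[THEN trig_poly_real_polynomial]
  have "trig_poly (\<lambda>x. of_real (Re (p (torus_embedding x))) + \<i> * of_real (Im (p (torus_embedding x))))"
    by (intro trig_poly.add trig_poly_mult trig_poly_const) (simp_all add: o_def)
  then show ?thesis by (simp add: complex_eq[symmetric])
qed

text \<open>A continuous periodic function factors through the compact torus embedded in
  complex Euclidean space, where Stone--Weierstrass applies.\<close>

lemma trig_poly_dense:
  fixes f :: "real^'n::finite \<Rightarrow> complex"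
  assumes f: "continuous_on UNIV f" "torus_periodic f" and "0 < e"
  obtains t where "trig_poly t" "\<And>x. x \<in> torus_box \<Longrightarrow> norm (f x - t x) < e"
proof -
  define K where "K = torus_embedding ` (torus_box :: (real^'n) set)"
  \<comment> \<open>The embedding is not injective on the closed box, since opposite faces have the
    same image. The preimage picked by \<open>inv_into\<close> does not matter, as \<open>f\<close>
    takes equal values on all of them.\<close>
  define g where "g v = f (inv_into torus_box torus_embedding v)" for v
  have g: "g (torus_embedding x) = f x" if "x \<in> torus_box" for x
  proof -
    have "torus_embedding (inv_into torus_box torus_embedding (torus_embedding x)) = torus_embedding x"
      using that by (intro f_inv_into_f) simp
    then show ?thesis unfolding g_def by (rule torus_embedding_eq[OF f(2)])
  qed
  have K: "compact K"
    unfolding K_def by (intro compact_continuous_image continuous_torus_embedding compact_cbox)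
  \<comment> \<open>The quotient-map argument: a closed preimage under \<open>f\<close>, intersected
    with the compact box, is compact, and its image under the embedding is exactly the preimage
    under \<open>g\<close>.\<close>
  have "continuous_on K g"
    unfolding continuous_on_closed_vimage[OF compact_imp_closed[OF K]]
  proof (intro allI impI)
    fix B :: "complex set" assume "closed B"
    then have "closed (f -` B)"
      using f(1) by (simp add: continuous_on_closed_vimage[OF closed_UNIV])
    then have "compact (f -` B \<inter> torus_box)"
      by (intro closed_Int_compact compact_cbox)
    then have "closed (torus_embedding ` (f -` B \<inter> torus_box))"
      by (intro compact_imp_closed compact_continuous_image continuous_torus_embedding)
    moreover have "g -` B \<inter> K = torus_embedding ` (f -` B \<inter> torus_box)"
      unfolding K_def using g by auto
    ultimately show "closed (g -` B \<inter> K)" by simp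
  qed
  from Stone_Weierstrass_polynomial_function[OF K this \<open>0 < e\<close>]
  obtain p where p: "polynomial_function p" "\<And>v. v \<in> K \<Longrightarrow> norm (g v - p v) < e" by blast
  show ?thesis
  proof
    show "trig_poly (\<lambda>x. p (torus_embedding x))" by (rule trig_poly_polynomial[OF p(1)])
    fix x :: "real^'n" assume x: "x \<in> torus_box"
    then have "torus_embedding x \<in> K" unfolding K_def by (rule imageI)
    from p(2)[OF this] show "norm (f x - p (torus_embedding x)) < e" by (simp add: g[OF x])
  qed
qed

lemma trig_poly_orthogonal:
  assumes "trig_poly t" "continuous_on UNIV f" "\<And>\<eta>. torus_integral (\<lambda>x. f x * character \<eta> x) = 0"
  shows "torus_integral (\<lambda>x. f x * t x) = 0"
  using assms(1)
proof induction
  case (monomial c \<eta>)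
  have "torus_integral (\<lambda>x. c * (f x * character \<eta> x)) = 0"
    unfolding torus_integral_cmult assms(3) by simp
  then show ?case by (simp add: mult_ac)
next
  case (add t1 t2)
  have "torus_integral (\<lambda>x. f x * t1 x + f x * t2 x) = 0"
    using add.IH by (subst torus_integral_add)
      (intro continuous_on_mult assms(2) trig_poly_continuous[OF add.hyps(1)]
        trig_poly_continuous[OF add.hyps(2)] | simp)+
  then show ?case by (simp add: distrib_left)
qed

text \<open>Since \<open>f\<close> is orthogonal to every trigonometric polynomial t, the integral
  of |f|^2 equals that of f (cnj f - t), which is arbitrarily small when t approximates the
  conjugate of \<open>f\<close>. A nonnegative continuous function with integral zero
  vanishes.\<close>

lemma fourier_coefficients_zero:
  fixes f :: "real^'n::finite \<Rightarrow> complex"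
  assumes f: "continuous_on UNIV f" "torus_periodic f"
    and coeffs: "\<And>\<eta>. torus_integral (\<lambda>x. f x * character \<eta> x) = 0"
  shows "f x = 0"
proof -
  let ?V = "(2 * pi) ^ CARD('n)"
  obtain B0 where B0: "\<And>x. norm (f x) \<le> B0" using torus_periodic_bounded[OF f(2,1)] by blast
  \<comment> \<open>Adding 1 makes the bound strictly positive, so that it may appear in a
    denominator.\<close>
  define B where "B = B0 + 1"
  have B: "norm (f x) \<le> B" "0 < B" for x
    using B0[of x] norm_ge_zero[of "f x"] unfolding B_def by linarith+
  have contn: "continuous_on UNIV (\<lambda>x. f x * cnj (f x))"
    by (intro continuous_intros f(1))
  have small: "norm (torus_integral (\<lambda>x. f x * cnj (f x))) \<le> e" if "e > 0" for e
  proof -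
    \<comment> \<open>This accuracy is what remains of \<open>e\<close> after dividing by the bound
      for \<open>f\<close> and the volume of the box.\<close>
    have d: "0 < e / (B * ?V)" using that B(2) by simp
    have "continuous_on UNIV (\<lambda>x. cnj (f x))" by (intro continuous_intros f(1))
    moreover have "torus_periodic (\<lambda>x. cnj (f x))" using f(2) by (simp add: torus_periodic_def)
    ultimately obtain t where t: "trig_poly t" "\<And>x. x \<in> torus_box \<Longrightarrow> norm (cnj (f x) - t x) < e / (B * ?V)"
      using trig_poly_dense[OF _ _ d] by metis
    have contt: "continuous_on UNIV t" by (rule trig_poly_continuous[OF t(1)])
    have "torus_integral (\<lambda>x. f x * cnj (f x) - f x * t x) = torus_integral (\<lambda>x. f x * cnj (f x))"
      using trig_poly_orthogonal[OF t(1) f(1) coeffs]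
      by (subst torus_integral_diff) (auto intro!: continuous_on_mult f(1) contt contn)
    moreover have "norm (torus_integral (\<lambda>x. f x * cnj (f x) - f x * t x)) \<le> (B * (e / (B * ?V))) * ?V"
    proof (rule norm_torus_integral_le)
      show "continuous_on UNIV (\<lambda>x. f x * cnj (f x) - f x * t x)"
        by (intro continuous_on_diff continuous_on_mult f(1) contt contn)
      fix x :: "real^'n" assume "x \<in> torus_box"
      then have "norm (f x) * norm (cnj (f x) - t x) \<le> B * (e / (B * ?V))"
        using t(2)[of x] B d by (intro mult_mono) (auto simp: less_imp_le)
      then show "norm (f x * cnj (f x) - f x * t x) \<le> B * (e / (B * ?V))"
        by (simp add: norm_mult[symmetric] right_diff_distrib)
    qed
    moreover have "(B * (e / (B * ?V))) * ?V = e" using B(2) by simp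
    ultimately show ?thesis by simp
  qed
  then have "torus_integral (\<lambda>x. f x * cnj (f x)) = 0"
    using field_le_epsilon[of "norm (torus_integral (\<lambda>x. f x * cnj (f x)))" 0] by simp
  then have "((\<lambda>x. f x * cnj (f x)) has_integral 0) torus_box"
    unfolding torus_integral_def using continuous_torus_integrable[OF contn] integrable_integral by metis
  from has_integral_linear[OF this bounded_linear_Re]
  have "((\<lambda>x. Re (f x * cnj (f x))) has_integral 0) torus_box" by (simp add: o_def)
  moreover have "continuous_on torus_box (\<lambda>x. Re (f x * cnj (f x)))"
    by (intro continuous_on_Re continuous_on_subset[OF contn]) auto
  moreover have "box 0 (\<chi> i. 2 * pi) \<noteq> ({} :: (real^'n) set)"
    by (simp add: interval_ne_empty_cart)
  moreover have "0 \<le> Re (f x * cnj (f x))" for x by (simp add: complex_mult_cnj)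
  ultimately have "Re (f y * cnj (f y)) = 0" if "y \<in> torus_box" for y
    using has_integral_0_cbox_imp_0[of 0 "\<chi> i. 2 * pi" "\<lambda>x. Re (f x * cnj (f x))" y] that by blast
  then have "f y = 0" if "y \<in> torus_box" for y
    using that by (simp add: complex_mult_cnj complex_eq_iff sum_power2_eq_zero_iff)
  then show ?thesis by (metis torus_periodic_reduce[OF f(2)])
qed

section \<open>Distributions evaluated on Fourier series\<close>

lemma rapidly_decaying_restrict:
  "rapidly_decaying c \<Longrightarrow> rapidly_decaying (\<lambda>\<eta>. if P \<eta> then c \<eta> else 0)"
  by (erule rapidly_decaying_le) auto

lemma has_sum_restrict:
  fixes f :: "'a \<Rightarrow> 'b::{t2_space, comm_monoid_add}"
  assumes "finite F"
  shows "((\<lambda>x. if x \<in> F then f x else 0) has_sum sum f F) UNIV"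
proof -
  have "(f has_sum sum f F) F" using assms by simp
  then show ?thesis by (subst has_sum_cong_neutral[of F UNIV f]) auto
qed

lemma fourier_series_finite:
  "finite F \<Longrightarrow> fourier_series (\<lambda>\<eta>. if \<eta> \<in> F then c \<eta> else 0) x = (\<Sum>\<eta>\<in>F. c \<eta> * character \<eta> x)"
  unfolding fourier_series_def
  using has_sum_restrict[of F "\<lambda>\<eta>. c \<eta> * character \<eta> x"]
  by (intro infsumI) (simp add: if_distrib[of "\<lambda>a. a * _"] cong: if_cong)

lemma rapidly_decaying_finite:
  assumes "finite F"
  shows "rapidly_decaying (\<lambda>\<eta>. if \<eta> \<in> F then c \<eta> else 0)"
  unfolding rapidly_decaying_def
proof
  fix n
  let ?g = "\<lambda>\<eta>. norm (c \<eta>) * bracket \<eta> ^ n"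
  have "norm (if \<eta> \<in> F then c \<eta> else 0) * bracket \<eta> ^ n \<le> sum ?g F" for \<eta>
  proof -
    have "0 \<le> ?g \<xi>" for \<xi> using bracket_pos[of \<xi>] by simp
    then show ?thesis using member_le_sum[of \<eta> F ?g] assms by (auto intro: sum_nonneg)
  qed
  then show "\<exists>C. \<forall>\<eta>. norm (if \<eta> \<in> F then c \<eta> else 0) * bracket \<eta> ^ n \<le> C" by blast
qed

lemma character_smooth: "character \<eta> \<in> torus_smooth"
proof -
  have "character \<eta> = fourier_series (\<lambda>\<xi>. if \<xi> \<in> {\<eta>} then 1 else 0)"
    by (rule ext, subst fourier_series_finite) auto
  then show ?thesis
    using fourier_series_smooth[OF rapidly_decaying_finite[of "{\<eta>}" "\<lambda>_. 1"]] by simp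
qed

text \<open>Linearity gives the value on finite partial sums only. The rest is a Fourier series with
  the remaining coefficients, and continuity of \<open>u\<close> bounds its contribution by the tail
  of a convergent weighted sum.\<close>

lemma distribution_fourier_series:
  fixes c :: "int^'n::finite \<Rightarrow> complex"
  assumes u: "u \<in> distributions" and c: "rapidly_decaying c"
  shows "((\<lambda>\<eta>. c \<eta> * u (character \<eta>)) has_sum u (fourier_series c)) UNIV"
proof -
  have u_add: "u (\<lambda>x. \<phi> x + \<psi> x) = u \<phi> + u \<psi>" if "\<phi> \<in> torus_smooth" "\<psi> \<in> torus_smooth" for \<phi> \<psi>
    using u that unfolding distributions_def by blast
  have u_cmult: "u (\<lambda>x. a * \<phi> x) = a * u \<phi>" if "\<phi> \<in> torus_smooth" for a \<phi>
    using u that unfolding distributions_def by blast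
  obtain C0 k where C0: "\<And>\<phi>. \<phi> \<in> torus_smooth \<Longrightarrow> norm (u \<phi>) \<le> C0 * Ck_norm k \<phi>"
    using u unfolding distributions_def by blast
  define on off where "on F = (\<lambda>\<eta>. if \<eta> \<in> F then c \<eta> else 0)"
    and "off F = (\<lambda>\<eta>. if \<eta> \<notin> F then c \<eta> else 0)" for F
  have rapid: "rapidly_decaying (on F)" "rapidly_decaying (off F)" for F
    unfolding on_def off_def by (intro rapidly_decaying_restrict c)+
  have u_finite: "u (fourier_series (on F)) = (\<Sum>\<eta>\<in>F. c \<eta> * u (character \<eta>))" if "finite F" for F
    using that
  proof induction
    case empty
    \<comment> \<open>The empty series is 0 times itself, so homogeneity forces \<open>u\<close> to
      vanish on it.\<close>
    have "fourier_series (on {}) = (\<lambda>x. 0 * fourier_series (on {}) x)"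
      by (simp add: fun_eq_iff fourier_series_def on_def)
    then have "u (fourier_series (on {})) = 0 * u (fourier_series (on {}))"
      using u_cmult[OF fourier_series_smooth[OF rapid(1)]] by metis
    then show ?case by simp
  next
    case (insert \<eta> F)
    have "fourier_series (on (insert \<eta> F)) = (\<lambda>x. c \<eta> * character \<eta> x + fourier_series (on F) x)"
      unfolding on_def using insert.hyps
      by (intro ext) (simp add: fourier_series_finite del: insert_iff)
    moreover have "(\<lambda>x. c \<eta> * character \<eta> x) \<in> torus_smooth"
    proof -
      have "(\<lambda>x. c \<eta> * character \<eta> x) = fourier_series (on {\<eta>})"
        by (simp add: fun_eq_iff on_def fourier_series_finite[of "{\<eta>}", simplified])
      then show ?thesis using fourier_series_smooth[OF rapid(1)] by simp
    qed
    ultimately show ?case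
      using insert by (simp add: u_add u_cmult character_smooth fourier_series_smooth rapid)
  qed
  \<comment> \<open>Here \<open>k\<close> is the order of a norm in which \<open>u\<close> is
    continuous; the tail of \<open>w\<close> dominates that norm of the tail of the series.\<close>
  define w where "w \<eta> = norm (c \<eta>) * bracket \<eta> ^ k" for \<eta>
  have w: "(w has_sum infsum w UNIV) UNIV"
    unfolding w_def by (intro has_sum_infsum rapidly_decaying_summable c)
  have tail: "norm ((\<Sum>\<eta>\<in>F. c \<eta> * u (character \<eta>)) - u (fourier_series c)) \<le> \<bar>C0\<bar> * (infsum w UNIV - sum w F)"
    if F: "finite F" for F
  proof -
    have "fourier_series c x = fourier_series (on F) x + fourier_series (off F) x" for x
    proof -
      have "fourier_series (on F) x + fourier_series (off F) x
          = (\<Sum>\<^sub>\<infinity>\<eta>. on F \<eta> * character \<eta> x + off F \<eta> * character \<eta> x)"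
        unfolding fourier_series_def
        by (intro infsum_add[symmetric] fourier_series_summable rapidly_decaying_summable_norm rapid)
      also have "\<dots> = fourier_series c x"
        unfolding fourier_series_def by (intro infsum_cong) (simp add: on_def off_def)
      finally show ?thesis by simp
    qed
    then have "u (fourier_series c) = u (\<lambda>x. fourier_series (on F) x + fourier_series (off F) x)"
      by presburger
    also have "\<dots> = (\<Sum>\<eta>\<in>F. c \<eta> * u (character \<eta>)) + u (fourier_series (off F))"
      by (subst u_add) (auto intro: fourier_series_smooth rapid simp: u_finite[OF F])
    finally have "norm ((\<Sum>\<eta>\<in>F. c \<eta> * u (character \<eta>)) - u (fourier_series c)) = norm (u (fourier_series (off F)))"
      by (simp add: norm_minus_commute)
    also have "\<dots> \<le> C0 * Ck_norm k (fourier_series (off F))"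
      by (intro C0 fourier_series_smooth rapid)
    \<comment> \<open>The continuity constant has no prescribed sign, and the next estimate needs a
      nonnegative factor.\<close>
    also have "\<dots> \<le> \<bar>C0\<bar> * Ck_norm k (fourier_series (off F))"
      by (intro mult_right_mono Ck_norm_nonneg fourier_series_smooth rapid) simp
    also have "\<dots> \<le> \<bar>C0\<bar> * (\<Sum>\<^sub>\<infinity>\<eta>. norm (off F \<eta>) * bracket \<eta> ^ k)"
      by (intro mult_left_mono Ck_norm_fourier_series_le rapid) simp
    also have "(\<Sum>\<^sub>\<infinity>\<eta>. norm (off F \<eta>) * bracket \<eta> ^ k) = infsum w UNIV - sum w F"
    proof (rule infsumI)
      have "(\<lambda>\<eta>. norm (off F \<eta>) * bracket \<eta> ^ k) = (\<lambda>\<eta>. w \<eta> - (if \<eta> \<in> F then w \<eta> else 0))"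
        by (auto simp: fun_eq_iff off_def w_def)
      then show "((\<lambda>\<eta>. norm (off F \<eta>) * bracket \<eta> ^ k) has_sum (infsum w UNIV - sum w F)) UNIV"
        using has_sum_minus[OF w has_sum_restrict[OF F, of w]] by simp
    qed
    finally show ?thesis .
  qed
  have "((\<lambda>F. \<bar>C0\<bar> * (infsum w UNIV - sum w F)) \<longlongrightarrow> 0) (finite_subsets_at_top UNIV)"
    using w unfolding has_sum_def by (auto intro!: tendsto_eq_intros)
  then have "((\<lambda>F. (\<Sum>\<eta>\<in>F. c \<eta> * u (character \<eta>)) - u (fourier_series c)) \<longlongrightarrow> 0) (finite_subsets_at_top UNIV)"
  proof (rule Lim_null_comparison[rotated])
    show "\<forall>\<^sub>F F in finite_subsets_at_top UNIV.
        norm ((\<Sum>\<eta>\<in>F. c \<eta> * u (character \<eta>)) - u (fourier_series c)) \<le> \<bar>C0\<bar> * (infsum w UNIV - sum w F)"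
      using tail by (auto intro: eventually_finite_subsets_at_top_weakI)
  qed
  then show ?thesis unfolding has_sum_def by (rule Lim_transform2[OF tendsto_const, simplified] LIM_zero_cancel)
qed

lemma distribution_of_in_distributions:
  fixes f :: "real^'n::finite \<Rightarrow> complex"
  assumes "continuous_on UNIV f"
  shows "distribution_of f \<in> distributions"
proof -
  have "compact (f ` torus_box)"
    by (intro compact_continuous_image continuous_on_subset[OF assms]) auto
  from compact_imp_bounded[OF this] obtain B where B: "\<forall>y\<in>f ` torus_box. norm y \<le> B"
    unfolding bounded_iff ..
  have "norm (f 0) \<le> B" using B by (simp add: mem_box_cart)
  then have B0: "0 \<le> B" by (rule order_trans[OF norm_ge_zero])
  have cont: "continuous_on UNIV (\<lambda>y. f y * \<phi> y)" if "\<phi> \<in> torus_smooth" for \<phi>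
    by (intro continuous_on_mult assms torus_smooth_continuous that)
  have add: "distribution_of f (\<lambda>x. \<phi> x + \<psi> x) = distribution_of f \<phi> + distribution_of f \<psi>"
    if "\<phi> \<in> torus_smooth" "\<psi> \<in> torus_smooth" for \<phi> \<psi>
    by (simp add: distribution_of_def distrib_left torus_integral_add cont that)
  have cmult: "distribution_of f (\<lambda>x. c * \<phi> x) = c * distribution_of f \<phi>" for c \<phi>
    by (simp add: distribution_of_def torus_integral_cmult[symmetric] mult_ac)
  have bound: "norm (distribution_of f \<phi>) \<le> (B * (2 * pi) ^ CARD('n)) * Ck_norm 0 \<phi>"
    if "\<phi> \<in> torus_smooth" for \<phi>
  proof -
    have "norm (torus_integral (\<lambda>y. f y * \<phi> y)) \<le> (B * Ck_norm 0 \<phi>) * (2 * pi) ^ CARD('n)"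
    proof (rule norm_torus_integral_le[OF cont[OF that]])
      fix x :: "real^'n" assume "x \<in> torus_box"
      then show "norm (f x * \<phi> x) \<le> B * Ck_norm 0 \<phi>"
        using B B0 unfolding norm_mult by (intro mult_mono norm_le_Ck_norm that) auto
    qed
    then show ?thesis by (simp add: distribution_of_def mult_ac)
  qed
  show ?thesis unfolding distributions_def using add cmult bound by blast
qed

lemma distribution_of_character:
  "distribution_of (character \<xi>) (character \<eta>)
    = (if \<xi> = - \<eta> then (2 * of_real pi) ^ CARD('n) else 0)" for \<xi> \<eta> :: "int^'n::finite"
proof -
  have "distribution_of (character \<xi>) (character \<eta>) = torus_integral (character (\<xi> + \<eta>))"
    by (simp add: distribution_of_def character_add[abs_def])
  then show ?thesis by (simp add: torus_integral_character eq_neg_iff_add_eq_0)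
qed

lemma distribution_of_commute: "distribution_of f g = distribution_of g f"
  by (simp add: distribution_of_def mult.commute)

lemma infsum_character_coefficient:
  fixes c :: "int^'n::finite \<Rightarrow> complex"
  shows "(\<Sum>\<^sub>\<infinity>\<eta>. c \<eta> * distribution_of (character \<eta>) (character (- \<xi>))) = c \<xi> * (2 * of_real pi) ^ CARD('n)"
proof -
  have "(\<lambda>\<eta>. c \<eta> * distribution_of (character \<eta>) (character (- \<xi>)))
      = (\<lambda>\<eta>. if \<eta> \<in> {\<xi>} then c \<eta> * (2 * of_real pi) ^ CARD('n) else 0)"
    by (auto simp: fun_eq_iff distribution_of_character)
  then show ?thesis
    using has_sum_restrict[of "{\<xi>}" "\<lambda>\<eta>. c \<eta> * (2 * of_real pi) ^ CARD('n)"] by (simp add: infsumI)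
qed

text \<open>The symmetric pairing lets the character act as the distribution and the series as the
  test function; interchanging sum and integral is then an instance of
  \<open>distribution_fourier_series\<close>.\<close>

lemma fourier_coeff_fourier_series:
  assumes "rapidly_decaying c"
  shows "fourier_coeff (distribution_of (fourier_series c)) \<xi> = c \<xi>"
proof -
  have "distribution_of (fourier_series c) (character (- \<xi>))
      = (\<Sum>\<^sub>\<infinity>\<eta>. c \<eta> * distribution_of (character (- \<xi>)) (character \<eta>))"
    unfolding distribution_of_commute[of "fourier_series c"]
    by (intro infsumI[symmetric] distribution_fourier_series assms distribution_of_in_distributions
        continuous_character)
  then show ?thesis
    by (simp add: distribution_of_commute[of "character (- \<xi>)"] infsum_character_coefficient fourier_coeff_def)
qed

lemma rapidly_decaying_fourier_coeff:
  fixes \<phi> :: "real^'n::finite \<Rightarrow> complex"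
  assumes "\<phi> \<in> torus_smooth"
  shows "rapidly_decaying (fourier_coeff (distribution_of \<phi>))"
  unfolding rapidly_decaying_def
proof
  fix k
  let ?V = "(2 * pi) ^ CARD('n)"
  have "norm (fourier_coeff (distribution_of \<phi>) \<eta>) * bracket \<eta> ^ k \<le> (1 + CARD('n)) ^ k * ?V * Ck_norm k \<phi> / ?V" for \<eta>
    using torus_integral_character_decay[OF assms, of "- \<eta>" k]
    by (simp add: fourier_coeff_def distribution_of_def bracket_uminus norm_divide norm_mult norm_power divide_le_eq mult_ac)
  then show "\<exists>C. \<forall>\<eta>. norm (fourier_coeff (distribution_of \<phi>) \<eta>) * bracket \<eta> ^ k \<le> C" by blast
qed

text \<open>The series has the same coefficients as \<phi>, so completeness of the characters
  annihilates the difference.\<close>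

lemma fourier_inversion:
  assumes "\<phi> \<in> torus_smooth"
  shows "\<phi> = fourier_series (fourier_coeff (distribution_of \<phi>))"
proof
  fix x
  let ?S = "fourier_series (fourier_coeff (distribution_of \<phi>))"
  have S: "?S \<in> torus_smooth"
    by (intro fourier_series_smooth rapidly_decaying_fourier_coeff assms)
  have cont: "continuous_on UNIV \<phi>" "continuous_on UNIV ?S"
    by (intro torus_smooth_continuous assms S)+
  have "\<phi> x - ?S x = 0"
  proof (rule fourier_coefficients_zero)
    show "continuous_on UNIV (\<lambda>x. \<phi> x - ?S x)" by (intro continuous_on_diff cont)
    show "torus_periodic (\<lambda>x. \<phi> x - ?S x)"
      using torus_smooth_periodic[OF assms] torus_smooth_periodic[OF S] by (simp add: torus_periodic_def)
    fix \<eta>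
    have "fourier_coeff (distribution_of ?S) (- \<eta>) = fourier_coeff (distribution_of \<phi>) (- \<eta>)"
      by (rule fourier_coeff_fourier_series[OF rapidly_decaying_fourier_coeff[OF assms]])
    then have "torus_integral (\<lambda>x. ?S x * character \<eta> x) = torus_integral (\<lambda>x. \<phi> x * character \<eta> x)"
      by (simp add: fourier_coeff_def distribution_of_def)
    then have "torus_integral (\<lambda>x. \<phi> x * character \<eta> x - ?S x * character \<eta> x) = 0"
      by (subst torus_integral_diff) (auto intro!: continuous_on_mult cont continuous_character)
    then show "torus_integral (\<lambda>x. (\<phi> x - ?S x) * character \<eta> x) = 0" by (simp add: left_diff_distrib)
  qed
  then show "\<phi> x = ?S x" by simp
qed

text \<open>The test function is the sum of its own rapidly convergent Fourier series, and both
  functionals may be applied to it term by term.\<close>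

lemma distribution_eqI:
  assumes "u \<in> distributions" "v \<in> distributions"
    and coeffs: "\<And>\<eta>. fourier_coeff u \<eta> = fourier_coeff v \<eta>" and \<phi>: "\<phi> \<in> torus_smooth"
  shows "u \<phi> = v \<phi>"
proof -
  let ?c = "fourier_coeff (distribution_of \<phi>)"
  have c: "rapidly_decaying ?c" by (rule rapidly_decaying_fourier_coeff[OF \<phi>])
  have "u (character \<eta>) = v (character \<eta>)" for \<eta>
    using coeffs[of "- \<eta>"] by (simp add: fourier_coeff_def)
  then have "u (fourier_series ?c) = v (fourier_series ?c)"
    using has_sum_unique[OF distribution_fourier_series[OF assms(1) c]]
      distribution_fourier_series[OF assms(2) c] by simp
  then show ?thesis using fourier_inversion[OF \<phi>] by simp
qed

lemma is_smoothI:
  fixes u :: "(real^'n::finite \<Rightarrow> complex) \<Rightarrow> complex"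
  assumes "u \<in> distributions" "rapidly_decaying (fourier_coeff u)"
  shows "is_smooth u"
  unfolding is_smooth_def
proof (intro bexI ballI)
  let ?f = "fourier_series (fourier_coeff u)"
  show f: "?f \<in> torus_smooth" by (rule fourier_series_smooth[OF assms(2)])
  fix \<phi> :: "real^'n \<Rightarrow> complex" assume \<phi>: "\<phi> \<in> torus_smooth"
  show "u \<phi> = distribution_of ?f \<phi>"
  proof (rule distribution_eqI[OF assms(1) _ _ \<phi>])
    show "distribution_of ?f \<in> distributions"
      by (rule distribution_of_in_distributions[OF torus_smooth_continuous[OF f]])
    show "fourier_coeff u \<eta> = fourier_coeff (distribution_of ?f) \<eta>" for \<eta>
      by (rule fourier_coeff_fourier_series[OF assms(2), symmetric])
  qed
qed

lemma is_smooth_rapidly_decaying: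
  assumes "is_smooth u"
  shows "rapidly_decaying (fourier_coeff u)"
proof -
  obtain f where f: "f \<in> torus_smooth" "\<And>\<phi>. \<phi> \<in> torus_smooth \<Longrightarrow> u \<phi> = distribution_of f \<phi>"
    using assms unfolding is_smooth_def by blast
  then have "fourier_coeff u = fourier_coeff (distribution_of f)"
    by (simp add: fun_eq_iff fourier_coeff_def character_smooth)
  then show ?thesis using rapidly_decaying_fourier_coeff[OF f(1)] by simp
qed

section \<open>Distributions with polynomially bounded Fourier coefficients\<close>

definition series_distribution :: "(int^'n::finite \<Rightarrow> complex) \<Rightarrow> (real^'n \<Rightarrow> complex) \<Rightarrow> complex" where
  "series_distribution c \<phi> = (\<Sum>\<^sub>\<infinity>\<eta>. c \<eta> * distribution_of (character \<eta>) \<phi>)"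

text \<open>Holds for arbitrary \<open>c\<close>: paired with a character, only one term of the
  series is nonzero, so convergence is automatic.\<close>

lemma fourier_coeff_series_distribution: "fourier_coeff (series_distribution c) \<eta> = c \<eta>"
  by (simp add: fourier_coeff_def series_distribution_def infsum_character_coefficient)

lemma psido_eq_series_distribution: "psido a u = series_distribution (\<lambda>\<eta>. a \<eta> * fourier_coeff u \<eta>)"
  by (simp add: fun_eq_iff psido_def series_distribution_def)

lemma fourier_coeff_psido_system:
  "fourier_coeff (psido_system A u j) \<eta> = (\<Sum>k\<in>UNIV. A \<eta> $ j $ k * fourier_coeff (u k) \<eta>)"
proof -
  have "fourier_coeff (psido_system A u j) \<eta> = (\<Sum>k\<in>UNIV. fourier_coeff (psido (\<lambda>\<eta>. A \<eta> $ j $ k) (u k)) \<eta>)"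
    unfolding fourier_coeff_def psido_system_def by (simp add: sum_divide_distrib)
  then show ?thesis by (simp add: psido_eq_series_distribution fourier_coeff_series_distribution)
qed

text \<open>One estimate serves two purposes: for fixed \<phi> it gives absolute summability of the
  pairing, and its factor \<open>Ck_norm k \<phi>\<close> gives continuity in \<phi>.\<close>

lemma series_distribution_bound:
  assumes "poly_bounded (c :: int^'n::finite \<Rightarrow> complex)"
  obtains K k where "\<And>\<phi> \<eta>. \<phi> \<in> torus_smooth \<Longrightarrow>
    norm (c \<eta> * distribution_of (character \<eta>) \<phi>) \<le> K * Ck_norm k \<phi> * (1 / bracket \<eta> ^ (2 * CARD('n)))"
proof -
  obtain C n where C: "0 \<le> C" "\<And>\<eta>. norm (c \<eta>) \<le> C * bracket \<eta> ^ n"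
    using poly_bounded_nonneg[OF assms] by blast
  \<comment> \<open>Of these derivatives of the test function, n compensate the growth of
    \<open>c\<close> and 2N make the series summable.\<close>
  define k where "k = n + 2 * CARD('n)"
  define K where "K = real (1 + CARD('n)) ^ k * (2 * pi) ^ CARD('n)"
  have "norm (c \<eta> * distribution_of (character \<eta>) \<phi>) \<le> (C * K) * Ck_norm k \<phi> * (1 / bracket \<eta> ^ (2 * CARD('n)))"
    if \<phi>: "\<phi> \<in> torus_smooth" for \<phi> :: "real^'n \<Rightarrow> complex" and \<eta>
  proof -
    let ?d = "norm (distribution_of (character \<eta>) \<phi>)"
    have d: "?d * bracket \<eta> ^ k \<le> K * Ck_norm k \<phi>"
      using torus_integral_character_decay[OF \<phi>, of \<eta> k] unfolding K_def
      by (simp add: distribution_of_def mult.commute[of "character \<eta> _"])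
    have "norm (c \<eta>) * ?d * bracket \<eta> ^ (2 * CARD('n)) \<le> (C * bracket \<eta> ^ n) * ?d * bracket \<eta> ^ (2 * CARD('n))"
      using bracket_pos[of \<eta>] by (intro mult_right_mono C) auto
    also have "\<dots> = C * (?d * bracket \<eta> ^ k)" by (simp add: k_def power_add)
    also have "\<dots> \<le> C * (K * Ck_norm k \<phi>)" by (intro mult_left_mono d C(1))
    finally show ?thesis
      using bracket_pos[of \<eta>] by (simp add: norm_mult pos_le_divide_eq mult_ac)
  qed
  then show ?thesis by (rule that)
qed

lemma series_distribution_abs_summable:
  assumes "poly_bounded c" "\<phi> \<in> torus_smooth"
  shows "(\<lambda>\<eta>. norm (c \<eta> * distribution_of (character \<eta>) \<phi>)) summable_on UNIV"
proof -
  obtain K k where "\<And>\<phi> \<eta>. \<phi> \<in> torus_smooth \<Longrightarrow>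
    norm (c \<eta> * distribution_of (character \<eta>) \<phi>) \<le> K * Ck_norm k \<phi> * (1 / bracket \<eta> ^ (2 * CARD('a)))"
    using series_distribution_bound[OF assms(1)] by blast
  with assms(2) show ?thesis
    by (intro summable_on_comparison_test[OF summable_on_cmult_right[OF summable_bracket]]) auto
qed

lemma series_distribution_summable:
  "poly_bounded c \<Longrightarrow> \<phi> \<in> torus_smooth \<Longrightarrow>
    (\<lambda>\<eta>. c \<eta> * distribution_of (character \<eta>) \<phi>) summable_on UNIV"
  by (rule abs_summable_summable[OF series_distribution_abs_summable])

lemma series_distribution_in_distributions:
  fixes c :: "int^'n::finite \<Rightarrow> complex"
  assumes c: "poly_bounded c"
  shows "series_distribution c \<in> distributions"
proof -
  have linear: "distribution_of (character \<eta>) (\<lambda>x. \<phi> x + \<psi> x)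
      = distribution_of (character \<eta>) \<phi> + distribution_of (character \<eta>) \<psi>"
    if "\<phi> \<in> torus_smooth" "\<psi> \<in> torus_smooth" for \<eta> \<phi> \<psi>
    using distribution_of_in_distributions[OF continuous_character] that unfolding distributions_def by blast
  have add: "series_distribution c (\<lambda>x. \<phi> x + \<psi> x) = series_distribution c \<phi> + series_distribution c \<psi>"
    if "\<phi> \<in> torus_smooth" "\<psi> \<in> torus_smooth" for \<phi> \<psi>
    unfolding series_distribution_def
    by (subst infsum_add[symmetric]) (auto intro: series_distribution_summable c that simp: linear[OF that] distrib_left)
  have scale: "series_distribution c (\<lambda>x. a * \<phi> x) = a * series_distribution c \<phi>"
    for a and \<phi> :: "real^'n \<Rightarrow> complex"
  proof -
    have "distribution_of (character \<eta>) (\<lambda>x. a * \<phi> x) = a * distribution_of (character \<eta>) \<phi>" for \<eta>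
      by (simp add: distribution_of_def torus_integral_cmult[symmetric] mult_ac)
    then show ?thesis
      unfolding series_distribution_def infsum_cmult_right'[symmetric] by (simp add: mult_ac)
  qed
  obtain K k where K: "\<And>\<phi> \<eta>. \<phi> \<in> torus_smooth \<Longrightarrow>
    norm (c \<eta> * distribution_of (character \<eta>) \<phi>) \<le> K * Ck_norm k \<phi> * (1 / bracket \<eta> ^ (2 * CARD('n)))"
    using series_distribution_bound[OF c] by blast
  have bound: "norm (series_distribution c \<phi>) \<le>
      (K * (\<Sum>\<^sub>\<infinity>\<eta>::int^'n. 1 / bracket \<eta> ^ (2 * CARD('n)))) * Ck_norm k \<phi>"
    if \<phi>: "\<phi> \<in> torus_smooth" for \<phi>
  proof -
    have "norm (series_distribution c \<phi>) \<le> (\<Sum>\<^sub>\<infinity>\<eta>. norm (c \<eta> * distribution_of (character \<eta>) \<phi>))"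
      unfolding series_distribution_def by (intro norm_infsum_bound series_distribution_abs_summable c \<phi>)
    also have "\<dots> \<le> (\<Sum>\<^sub>\<infinity>\<eta>::int^'n. K * Ck_norm k \<phi> * (1 / bracket \<eta> ^ (2 * CARD('n))))"
      by (intro infsum_mono series_distribution_abs_summable c \<phi> K summable_on_cmult_right summable_bracket)
    also have "\<dots> = K * Ck_norm k \<phi> * (\<Sum>\<^sub>\<infinity>\<eta>::int^'n. 1 / bracket \<eta> ^ (2 * CARD('n)))"
      by (rule infsum_cmult_right')
    finally show ?thesis by (simp only: mult_ac)
  qed
  show ?thesis unfolding distributions_def using add scale bound by blast
qed

text \<open>The finite sum over the columns is exchanged with the series over the lattice. The
  identity is restricted to smooth \<phi>, for which each of the series converges;
  \<open>is_smooth\<close> sees only these values.\<close>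

lemma psido_system_series_distribution:
  assumes A: "\<And>k. poly_bounded (\<lambda>\<eta>. A \<eta> $ j $ k)" and v: "\<And>k. poly_bounded (v k)"
    and \<phi>: "\<phi> \<in> torus_smooth"
  shows "psido_system A (\<lambda>k. series_distribution (v k)) j \<phi>
    = series_distribution (\<lambda>\<eta>. \<Sum>k\<in>UNIV. A \<eta> $ j $ k * v k \<eta>) \<phi>"
proof -
  have "psido_system A (\<lambda>k. series_distribution (v k)) j \<phi>
      = (\<Sum>k\<in>UNIV. \<Sum>\<^sub>\<infinity>\<eta>. A \<eta> $ j $ k * v k \<eta> * distribution_of (character \<eta>) \<phi>)"
    by (simp add: psido_system_def psido_def fourier_coeff_series_distribution)
  also have "\<dots> = (\<Sum>\<^sub>\<infinity>\<eta>. \<Sum>k\<in>UNIV. A \<eta> $ j $ k * v k \<eta> * distribution_of (character \<eta>) \<phi>)"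
    by (rule infsumI[symmetric], rule has_sum_sum_infsum)
      (intro series_distribution_summable poly_bounded_mult A v \<phi>)
  finally show ?thesis by (simp add: series_distribution_def sum_distrib_right)
qed

lemma is_smooth_cong:
  "(\<And>\<phi>. \<phi> \<in> torus_smooth \<Longrightarrow> u \<phi> = v \<phi>) \<Longrightarrow> is_smooth u \<longleftrightarrow> is_smooth v"
  by (simp add: is_smooth_def)

section \<open>Characteristic polynomial, determinant and eigenvectors\<close>

lemma poly_charpoly: "poly (charpoly A) z = det (mat z - A)"
proof -
  have "poly ((mat [:0, 1:] - (\<chi> j k. [:A $ j $ k:])) $ i $ j) z = (mat z - A) $ i $ j" for i j
    by (simp add: mat_def)
  moreover have "poly (of_int m) z = of_int m" for m by (cases m) simp_all
  ultimately show ?thesis by (simp add: charpoly_def det_def poly_sum poly_prod)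
qed

text \<open>Evaluating both expressions of the characteristic polynomial at 0 gives the determinant
  and the product of the eigenvalues up to signs, which the norm removes.\<close>

lemma norm_det_eq_prod_eigenvalues:
  fixes A :: "complex^'m^'m::finite"
  assumes "eigenvalue_list A ev"
  shows "norm (det A) = (\<Prod>j\<in>UNIV. norm (ev j))"
proof -
  have "det (mat 0 - A) = (- 1) ^ CARD('m) * det A"
  proof -
    have "(\<Prod>i\<in>UNIV. (mat 0 - A) $ i $ p i) = (- 1) ^ CARD('m) * (\<Prod>i\<in>UNIV. A $ i $ p i)" for p
      using prod.distrib[of "\<lambda>_. - 1" "\<lambda>i. A $ i $ p i" UNIV] by (simp add: mat_def)
    then show ?thesis by (simp add: det_def sum_distrib_left mult_ac)
  qed
  then have "norm (poly (charpoly A) 0) = norm (det A)"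
    by (simp add: poly_charpoly norm_mult norm_power)
  then show ?thesis
    using assms by (simp add: eigenvalue_list_def poly_prod prod_norm[symmetric])
qed

text \<open>A kernel vector is divided by its coordinate of largest modulus. The upper bound 1 keeps
  the later coefficient sequences bounded, and the coordinate equal to 1 keeps them from all
  decaying.\<close>

lemma eigenvalue_list_eigenvector:
  fixes A :: "complex^'m^'m::finite"
  assumes "eigenvalue_list A ev"
  obtains w :: "'m \<Rightarrow> complex" and l where "\<And>k. norm (w k) \<le> 1" "w l = 1"
    "\<And>i. (\<Sum>k\<in>UNIV. A $ i $ k * w k) = ev j * w i"
proof -
  have "poly (charpoly A) (ev j) = 0"
    using assms by (auto simp: eigenvalue_list_def poly_prod)
  then have "\<not> invertible (mat (ev j) - A)"
    by (simp add: poly_charpoly invertible_det_nz)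
  then obtain v where v: "v \<noteq> 0" "(mat (ev j) - A) *v v = 0"
    using matrix_left_invertible_ker[of "mat (ev j) - A"] invertible_left_inverse[of "mat (ev j) - A"] by blast
  have eig: "(\<Sum>k\<in>UNIV. A $ i $ k * v $ k) = ev j * v $ i" for i
  proof -
    have "0 = ((mat (ev j) - A) *v v) $ i" by (simp add: v)
    also have "\<dots> = (\<Sum>k\<in>UNIV. (if i = k then ev j * v $ k else 0) - A $ i $ k * v $ k)"
      unfolding matrix_vector_mult_def by (simp, intro sum.cong) (auto simp: mat_def left_diff_distrib)
    also have "\<dots> = ev j * v $ i - (\<Sum>k\<in>UNIV. A $ i $ k * v $ k)"
      by (simp add: sum_subtractf)
    finally show ?thesis by simp
  qed
  define N where "N = Max (range (\<lambda>k. norm (v $ k)))"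
  have "N \<in> range (\<lambda>k. norm (v $ k))" unfolding N_def by (intro Max_in) auto
  then obtain l where l: "N = norm (v $ l)" by blast
  have le: "norm (v $ k) \<le> norm (v $ l)" for k
    unfolding l[symmetric] N_def by (intro Max_ge) auto
  have nz: "v $ l \<noteq> 0"
    using v(1) le by (auto simp: vec_eq_iff)
  show ?thesis
  proof
    show "norm (v $ k / v $ l) \<le> 1" for k using le[of k] nz by (simp add: norm_divide divide_le_eq)
    show "v $ l / v $ l = 1" using nz by simp
    show "(\<Sum>k\<in>UNIV. A $ i $ k * (v $ k / v $ l)) = ev j * (v $ i / v $ l)" for i
      using eig[of i] by (simp add: sum_divide_distrib[symmetric])
  qed
qed

section \<open>Global hypoellipticity and eigenvalues\<close>

definition poly_bounded_below :: "(int^'n::finite \<Rightarrow> complex) \<Rightarrow> bool" where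
  "poly_bounded_below ev \<longleftrightarrow> (\<exists>C>0. \<exists>M>0. \<exists>R>0. \<forall>\<eta>. norm (lattice_vec \<eta>) \<ge> R \<longrightarrow>
     norm (ev \<eta>) \<ge> C * norm (lattice_vec \<eta>) powr (- M))"

text \<open>Each term of the Leibniz expansion contains exactly one factor from the \<open>k\<close>-th column.\<close>

lemma rapidly_decaying_det_column:
  fixes A :: "int^'n::finite \<Rightarrow> complex^'m^'m::finite"
  assumes A: "\<And>i j. poly_bounded (\<lambda>\<eta>. A \<eta> $ i $ j)" and f: "\<And>i. rapidly_decaying (f i)"
  shows "rapidly_decaying (\<lambda>\<eta>. det (\<chi> i j. if j = k then f i \<eta> else A \<eta> $ i $ j))"
proof -
  let ?B = "\<lambda>\<eta> i j. if j = k then f i \<eta> else A \<eta> $ i $ j"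
  have "rapidly_decaying (\<lambda>\<eta>. of_int (sign p) * (\<Prod>i\<in>UNIV. ?B \<eta> i (p i)))" if p: "p permutes UNIV" for p
  proof -
    define l where "l = inv p k"
    have pl: "p i = k \<longleftrightarrow> i = l" for i
      unfolding l_def using permutes_inverses[OF p] by metis
    have "(\<Prod>i\<in>UNIV. ?B \<eta> i (p i)) = (\<Prod>i\<in>UNIV - {l}. A \<eta> $ i $ p i) * f l \<eta>" for \<eta>
      by (subst prod.remove[of UNIV l]) (auto simp: pl intro!: prod.cong)
    then show ?thesis
      by (simp add: mult.assoc[symmetric])
        (intro rapidly_decaying_mult f poly_bounded_mult poly_bounded_const poly_bounded_prod A)
  qed
  then show ?thesis unfolding det_def by (auto intro!: rapidly_decaying_sum)
qed

text \<open>The predicate \<open>P\<close> cuts the reciprocal off where the lower bound may fail.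
  Positivity of \<open>R\<close> keeps \<eta> away from the origin, so the lower bound is strictly
  positive on \<open>P\<close> and can be inverted.\<close>

lemma poly_bounded_inverse:
  assumes "0 < C" "0 < M" "0 < R"
    and le: "\<And>\<eta>. norm (lattice_vec \<eta>) \<ge> R \<Longrightarrow> norm (ev \<eta>) \<ge> C * norm (lattice_vec \<eta>) powr (- M)"
    and P: "\<And>\<eta>. P \<eta> \<Longrightarrow> norm (lattice_vec \<eta>) \<ge> R"
  shows "poly_bounded (\<lambda>\<eta>. if P \<eta> then 1 / ev \<eta> else 0)"
proof -
  define n where "n = nat \<lceil>M\<rceil>"
  have "norm (if P \<eta> then 1 / ev \<eta> else 0) \<le> (1 / C) * bracket \<eta> ^ n" for \<eta>
  proof (cases "P \<eta>")
    case True
    define r where "r = norm (lattice_vec \<eta>)"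
    have r: "0 < r" "r \<le> bracket \<eta>" using P[OF True] assms(3) by (auto simp: r_def bracket_def)
    have ev: "C * r powr (- M) \<le> norm (ev \<eta>)" using le[OF P[OF True]] by (simp add: r_def)
    have pos: "0 < C * r powr (- M)" using r assms(1) by simp
    have "norm (1 / ev \<eta>) \<le> 1 / (C * r powr (- M))"
      unfolding norm_divide norm_one
      using assms(1) r(1) ev less_le_trans[OF pos ev] by (intro divide_left_mono mult_pos_pos) auto
    also have "\<dots> = (1 / C) * r powr M" by (simp add: powr_minus divide_inverse)
    also have "\<dots> \<le> (1 / C) * bracket \<eta> ^ n"
    proof (intro mult_left_mono)
      have "r powr M \<le> bracket \<eta> powr M" using r assms(2) by (intro powr_mono2) auto
      also have "\<dots> \<le> bracket \<eta> powr real n"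
        unfolding n_def by (intro powr_mono bracket_ge_1) linarith
      also have "\<dots> = bracket \<eta> ^ n" by (rule powr_realpow[OF bracket_pos])
      finally show "r powr M \<le> bracket \<eta> ^ n" .
    qed (use assms(1) in simp)
    finally show ?thesis using True by simp
  next
    case False
    then show ?thesis using assms(1) bracket_pos[of \<eta>] by simp
  qed
  then show ?thesis unfolding poly_bounded_def by blast
qed

lemma globally_hypoelliptic_if_eigenvalue_bounds:
  fixes A :: "int^'n::finite \<Rightarrow> complex^'m^'m::finite"
  assumes A: "\<And>i j. poly_bounded (\<lambda>\<eta>. A \<eta> $ i $ j)"
    and ev: "\<And>\<eta>. eigenvalue_list (A \<eta>) (\<lambda>j. ev j \<eta>)"
    and bound: "\<And>j. poly_bounded_below (ev j)"
  shows "globally_hypoelliptic A"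
  unfolding globally_hypoelliptic_def
proof (intro allI impI)
  fix u k
  assume u: "\<forall>k. u k \<in> distributions" and smooth: "\<forall>j. is_smooth (psido_system A u j)"
  obtain C M R where CMR: "\<And>j. 0 < C j" "\<And>j. 0 < M j" "\<And>j. 0 < R j"
    "\<And>j \<eta>. norm (lattice_vec \<eta>) \<ge> R j \<Longrightarrow> norm (ev j \<eta>) \<ge> C j * norm (lattice_vec \<eta>) powr (- M j)"
    using bound unfolding poly_bounded_below_def by metis
  \<comment> \<open>Beyond all the radii the bounds hold for every eigenvalue at once; only finitely
    many lattice points are excluded.\<close>
  define large where "large \<eta> \<longleftrightarrow> (\<forall>j. norm (lattice_vec \<eta>) \<ge> R j)" for \<eta> :: "int^'n"
  have "{\<eta>. \<not> large \<eta>} \<subseteq> (\<Union>j. {\<eta>. norm (lattice_vec \<eta>) \<le> R j})"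
    unfolding large_def by (force simp: not_le intro: less_imp_le)
  then have fin: "finite {\<eta>. \<not> large \<eta>}"
    by (rule finite_subset) (simp add: finite_bounded_lattice)
  define d where "d \<eta> = (if large \<eta> then 1 / det (A \<eta>) else 0)" for \<eta>
  have d: "poly_bounded d"
  proof -
    have "poly_bounded (\<lambda>\<eta>. \<Prod>j\<in>UNIV. if large \<eta> then 1 / ev j \<eta> else 0)"
      by (intro poly_bounded_prod poly_bounded_inverse[OF CMR]) (auto simp: large_def)
    moreover have "norm (d \<eta>) \<le> norm (\<Prod>j\<in>UNIV. if large \<eta> then 1 / ev j \<eta> else 0)" for \<eta>
      using norm_det_eq_prod_eigenvalues[OF ev]
      by (simp add: d_def norm_divide prod_norm[symmetric] prod_dividef)
    ultimately show ?thesis unfolding poly_bounded_def by (meson order_trans)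
  qed
  define f where "f j = fourier_coeff (psido_system A u j)" for j
  have f: "rapidly_decaying (f j)" for j
    unfolding f_def using smooth by (simp add: is_smooth_rapidly_decaying)
  \<comment> \<open>The numerator in Cramer's rule: column \<open>k\<close> is replaced by the
    coefficients of the image, so rapid decay passes to the whole determinant.\<close>
  define g where "g \<eta> = det (\<chi> i j. if j = k then f i \<eta> else A \<eta> $ i $ j)" for \<eta>
  have coeff: "fourier_coeff (u k) \<eta> = d \<eta> * g \<eta>" if "large \<eta>" for \<eta>
  proof -
    define x where "x = (\<chi> k. fourier_coeff (u k) \<eta>)"
    have "ev j \<eta> \<noteq> 0" for j
    proof -
      \<comment> \<open>The lower bound must be strictly positive to exclude a zero eigenvalue;
        \<open>R j > 0\<close> rules out the origin, where the power would be 0.\<close>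
      have "0 < C j * norm (lattice_vec \<eta>) powr (- M j)"
      proof (rule mult_pos_pos[OF CMR(1)])
        have "R j \<le> norm (lattice_vec \<eta>)" using that by (simp add: large_def)
        then have "norm (lattice_vec \<eta>) \<noteq> 0" using CMR(3)[of j] by linarith
        then show "0 < norm (lattice_vec \<eta>) powr (- M j)" by simp
      qed
      then show ?thesis using CMR(4)[of j \<eta>] that by (auto simp: large_def)
    qed
    then have "norm (det (A \<eta>)) \<noteq> 0"
      using norm_det_eq_prod_eigenvalues[OF ev, of \<eta>] by simp
    then have det: "det (A \<eta>) \<noteq> 0" by simp
    have "A \<eta> *v x = (\<chi> i. f i \<eta>)"
      by (simp add: matrix_vector_mult_def x_def f_def fourier_coeff_psido_system)
    with cramer[OF det] have "x $ k = g \<eta> / det (A \<eta>)"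
      by (simp add: g_def cong: if_cong)
    then show ?thesis using that by (simp add: x_def d_def)
  qed
  \<comment> \<open>The excluded frequencies are restored by a finitely supported correction. Since
    \<open>d\<close> is 0 there, the two summands do not overlap.\<close>
  have "rapidly_decaying (\<lambda>\<eta>. d \<eta> * g \<eta> + (if \<eta> \<in> {\<eta>. \<not> large \<eta>} then fourier_coeff (u k) \<eta> else 0))"
    unfolding g_def
    by (intro rapidly_decaying_add rapidly_decaying_mult rapidly_decaying_det_column
        rapidly_decaying_finite d fin A f)
  moreover have "d \<eta> * g \<eta> + (if \<eta> \<in> {\<eta>. \<not> large \<eta>} then fourier_coeff (u k) \<eta> else 0) = fourier_coeff (u k) \<eta>" for \<eta>
    using coeff[of \<eta>] by (auto simp: d_def)
  ultimately have "rapidly_decaying (fourier_coeff (u k))" by simp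
  then show "is_smooth (u k)" using u by (simp add: is_smoothI)
qed

text \<open>The decay exponent grows along the sequence, so for a given power \<open>n\<close> of
  the weight only the terms with index below \<open>n\<close> are not controlled by it, and these
  are finitely many. The points \<open>s l\<close> may repeat; any index representing \<eta> will
  do.\<close>

lemma rapidly_decaying_sparse:
  fixes s :: "nat \<Rightarrow> int^'n::finite"
  assumes s: "\<And>l. real (Suc l) \<le> norm (lattice_vec (s l))"
    and le: "\<And>l. norm (c (s l)) \<le> norm (lattice_vec (s l)) powr (- real (Suc l))"
    and zero: "\<And>\<eta>. \<eta> \<notin> range s \<Longrightarrow> c \<eta> = 0"
  shows "rapidly_decaying c"
  unfolding rapidly_decaying_def
proof
  fix n
  define T where "T = (\<Sum>l<n. norm (c (s l)) * bracket (s l) ^ n)"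
  have term0: "0 \<le> norm (c \<eta>) * bracket \<eta> ^ n" for \<eta>
    using bracket_pos[of \<eta>] by simp
  have T0: "0 \<le> T" unfolding T_def by (intro sum_nonneg term0)
  have "norm (c \<eta>) * bracket \<eta> ^ n \<le> T + 2 ^ n" for \<eta>
  proof (cases "\<eta> \<in> range s")
    case True
    then obtain l where l: "\<eta> = s l" by blast
    show ?thesis
    proof (cases "l < n")
      case True
      then have "norm (c (s l)) * bracket (s l) ^ n \<le> T"
        unfolding T_def by (intro member_le_sum term0) auto
      then show ?thesis using l by (simp add: add_increasing2)
    next
      case False
      define r where "r = norm (lattice_vec (s l))"
      have r: "1 \<le> r" using s[of l] unfolding r_def by simp
      \<comment> \<open>As r is at least 1, the bracket 1 + r is at most 2 r; and l \<ge> n makes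
        the combined exponent n - (l + 1) negative.\<close>
      have "norm (c (s l)) * bracket (s l) ^ n \<le> r powr (- real (Suc l)) * (2 * r) ^ n"
        using le[of l] r by (intro mult_mono power_mono) (auto simp: r_def bracket_def)
      also have "\<dots> = 2 ^ n * r powr (real n - real (Suc l))"
        using r by (simp add: power_mult_distrib powr_diff powr_minus powr_realpow divide_inverse
            del: of_nat_Suc)
      also have "\<dots> \<le> 2 ^ n * r powr 0"
        using r False by (intro mult_left_mono powr_mono) auto
      finally show ?thesis using r l T0 by simp
    qed
  next
    case False
    then show ?thesis using zero T0 by simp
  qed
  then show "\<exists>C. \<forall>\<eta>. norm (c \<eta>) * bracket \<eta> ^ n \<le> C" by blast
qed

lemma eigenvalue_bounds_if_globally_hypoelliptic:
  fixes A :: "int^'n::finite \<Rightarrow> complex^'m^'m::finite"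
  assumes A: "\<And>i j. poly_bounded (\<lambda>\<eta>. A \<eta> $ i $ j)"
    and ev: "\<And>\<eta>. eigenvalue_list (A \<eta>) (\<lambda>j. ev j \<eta>)"
    and gh: "globally_hypoelliptic A"
  shows "poly_bounded_below (ev j)"
proof (rule ccontr)
  assume contra: "\<not> poly_bounded_below (ev j)"
  \<comment> \<open>Failure of the bound is tested with C = 1 and M = R = l + 1, so a single integer
    drives both the distance from the origin and the rate of decay; \<open>Suc\<close> keeps these
    constants positive.\<close>
  have "\<exists>\<eta>. real (Suc l) \<le> norm (lattice_vec \<eta>) \<and> norm (ev j \<eta>) < norm (lattice_vec \<eta>) powr (- real (Suc l))" for l
  proof (rule ccontr)
    assume "\<not> ?thesis"
    then have "\<forall>\<eta>. norm (lattice_vec \<eta>) \<ge> real (Suc l) \<longrightarrow>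
        norm (ev j \<eta>) \<ge> 1 * norm (lattice_vec \<eta>) powr (- real (Suc l))"
      by (simp add: not_less)
    then have "poly_bounded_below (ev j)"
      unfolding poly_bounded_below_def
      by (intro exI[of _ "1 :: real"] exI[of _ "real (Suc l)"] conjI) auto
    with contra show False ..
  qed
  then obtain s where s: "\<And>l. real (Suc l) \<le> norm (lattice_vec (s l))"
    "\<And>l. norm (ev j (s l)) < norm (lattice_vec (s l)) powr (- real (Suc l))" by metis
  have "\<exists>w l. (\<forall>k. norm (w k) \<le> 1) \<and> w l = 1 \<and> (\<forall>i. (\<Sum>k\<in>UNIV. A \<eta> $ i $ k * w k) = ev j \<eta> * w i)" for \<eta>
    using eigenvalue_list_eigenvector[OF ev[of \<eta>], of j] by metis
  then obtain w l where w: "\<And>\<eta> k. norm (w \<eta> k) \<le> 1" "\<And>\<eta>. w \<eta> (l \<eta>) = 1"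
    "\<And>\<eta> i. (\<Sum>k\<in>UNIV. A \<eta> $ i $ k * w \<eta> k) = ev j \<eta> * w \<eta> i" by metis
  \<comment> \<open>Cutting off outside the chosen points leaves the eigenvector equation intact at
    every \<eta>, because both sides vanish elsewhere.\<close>
  define v where "v k \<eta> = (if \<eta> \<in> range s then w \<eta> k else 0)" for k \<eta>
  have v1: "norm (v k \<eta>) \<le> 1" for k \<eta> by (simp add: v_def w)
  have v: "poly_bounded (v k)" for k
    unfolding poly_bounded_def by (rule exI[of _ 1], rule exI[of _ 0]) (simp add: v1)
  have eig: "(\<Sum>k\<in>UNIV. A \<eta> $ i $ k * v k \<eta>) = ev j \<eta> * v i \<eta>" for \<eta> i
    by (simp add: v_def w(3))
  have decay: "rapidly_decaying (\<lambda>\<eta>. ev j \<eta> * v i \<eta>)" for i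
  proof (rule rapidly_decaying_sparse[OF s(1)])
    fix l
    have "norm (ev j (s l)) * norm (v i (s l)) \<le> norm (ev j (s l)) * 1"
      by (intro mult_left_mono v1) simp
    then show "norm (ev j (s l) * v i (s l)) \<le> norm (lattice_vec (s l)) powr (- real (Suc l))"
      using s(2)[of l] by (simp add: norm_mult)
  qed (simp add: v_def)
  have "is_smooth (psido_system A (\<lambda>k. series_distribution (v k)) i)" for i
  proof -
    have pb: "poly_bounded (\<lambda>\<eta>. ev j \<eta> * v i \<eta>)"
    proof -
      \<comment> \<open>Rapid decay with weight exponent 0 is boundedness.\<close>
      obtain C where "\<And>\<eta>. norm (ev j \<eta> * v i \<eta>) * bracket \<eta> ^ 0 \<le> C"
        using decay unfolding rapidly_decaying_def by blast
      then show ?thesis unfolding poly_bounded_def by (intro exI[of _ C] exI[of _ 0]) simp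
    qed
    have "is_smooth (series_distribution (\<lambda>\<eta>. ev j \<eta> * v i \<eta>))"
      by (rule is_smoothI[OF series_distribution_in_distributions[OF pb]])
        (use decay in \<open>simp add: fourier_coeff_series_distribution[abs_def]\<close>)
    then show ?thesis
      by (subst is_smooth_cong[OF psido_system_series_distribution[OF A v]]) (simp_all add: eig)
  qed
  then have "is_smooth (series_distribution (v k))" for k
    using gh[unfolded globally_hypoelliptic_def, rule_format, of "\<lambda>k. series_distribution (v k)"]
      series_distribution_in_distributions[OF v] by blast
  from is_smooth_rapidly_decaying[OF this]
  have "rapidly_decaying (v k)" for k by (simp add: fourier_coeff_series_distribution[abs_def])
  then have "\<exists>D. \<forall>\<eta>. norm (v k \<eta>) * bracket \<eta> ^ 1 \<le> D" for k
    unfolding rapidly_decaying_def by blast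
  then obtain D where D: "\<And>k \<eta>. norm (v k \<eta>) * bracket \<eta> ^ 1 \<le> D k" by metis
  \<comment> \<open>The coordinate \<open>l (s n)\<close> carrying the value 1 depends on
    \<open>n\<close>, so the constants \<open>D k\<close> are replaced by their maximum. Choosing
    \<open>n\<close> above this maximum contradicts |s n| \<ge> n + 1.\<close>
  define n where "n = nat \<lceil>Max (range D)\<rceil>"
  have "bracket (s n) \<le> D (l (s n))"
    using D[of "l (s n)" "s n"] by (simp add: v_def w(2))
  also have "\<dots> \<le> Max (range D)" by (intro Max_ge) auto
  also have "\<dots> \<le> real n" unfolding n_def by linarith
  finally show False using s(1)[of n] by (simp add: bracket_def)
qed

theorem theorem2p6:
  fixes L Q :: "int^'n::finite \<Rightarrow> complex^'m^'m::finite"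
    and \<epsilon>\<^sub>0 :: real
    and lam :: "'m \<Rightarrow> int^'n \<Rightarrow> complex"
    and \<sigma> :: "'m \<Rightarrow> nat \<Rightarrow> int^'n \<Rightarrow> complex"
  assumes "symbol_system L" and "symbol_system Q"
    and "\<epsilon>\<^sub>0 > 0"
    and "\<And>\<epsilon>::complex. norm \<epsilon> < \<epsilon>\<^sub>0 \<Longrightarrow> finite {\<eta>. det (perturbed L Q \<epsilon> \<eta>) = 0}"
    and "\<And>\<eta>. eigenvalue_list (L \<eta>) (\<lambda>j. lam j \<eta>)"
    and "\<And>\<epsilon> \<eta> j. norm \<epsilon> < \<epsilon>\<^sub>0 \<Longrightarrow> summable (\<lambda>k. \<sigma> j (Suc k) \<eta> * \<epsilon> ^ Suc k)"
    and "\<And>\<epsilon> \<eta>. norm \<epsilon> < \<epsilon>\<^sub>0 \<Longrightarrow>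
           eigenvalue_list (perturbed L Q \<epsilon> \<eta>) (\<lambda>j. lam j \<eta> + (\<Sum>k. \<sigma> j (Suc k) \<eta> * \<epsilon> ^ Suc k))"
  shows "\<forall>\<epsilon>::complex. norm \<epsilon> < \<epsilon>\<^sub>0 \<longrightarrow>
           (globally_hypoelliptic (perturbed L Q \<epsilon>) \<longleftrightarrow>
            (\<exists>C M R :: 'm \<Rightarrow> real. \<forall>j. C j > 0 \<and> M j > 0 \<and> R j > 0 \<and>
               (\<forall>\<eta>. norm (lattice_vec \<eta>) \<ge> R j \<longrightarrow>
                  norm (lam j \<eta> + (\<Sum>k. \<sigma> j (Suc k) \<eta> * \<epsilon> ^ Suc k))
                    \<ge> C j * norm (lattice_vec \<eta>) powr (- M j))))"
proof (intro allI impI)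
  fix \<epsilon> :: complex assume \<epsilon>: "norm \<epsilon> < \<epsilon>\<^sub>0"
  define ev where "ev j \<eta> = lam j \<eta> + (\<Sum>k. \<sigma> j (Suc k) \<eta> * \<epsilon> ^ Suc k)" for j \<eta>
  have entries: "poly_bounded (\<lambda>\<eta>. B \<eta> $ i $ j)" if "symbol_system B" for B :: "int^'n \<Rightarrow> complex^'m^'m" and i j
    using that symbol_of_order_poly_bounded unfolding symbol_system_def by blast
  \<comment> \<open>For fixed \<epsilon> the factor in front of \<open>Q\<close> is a constant, so
    the perturbed entries inherit polynomial growth.\<close>
  have A: "poly_bounded (\<lambda>\<eta>. perturbed L Q \<epsilon> \<eta> $ i $ j)" for i j
    unfolding perturbed_def
    by (simp, intro poly_bounded_add poly_bounded_mult poly_bounded_const entries assms(1,2))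
  have ev: "eigenvalue_list (perturbed L Q \<epsilon> \<eta>) (\<lambda>j. ev j \<eta>)" for \<eta>
    unfolding ev_def by (rule assms(7)[OF \<epsilon>])
  have "globally_hypoelliptic (perturbed L Q \<epsilon>) \<longleftrightarrow> (\<forall>j. poly_bounded_below (ev j))"
    using globally_hypoelliptic_if_eigenvalue_bounds[where ev = ev, OF A ev]
      eigenvalue_bounds_if_globally_hypoelliptic[where ev = ev, OF A ev] by blast
  \<comment> \<open>The constants chosen separately for each eigenvalue are collected into functions
    of the index.\<close>
  also have "\<dots> \<longleftrightarrow> (\<exists>C M R :: 'm \<Rightarrow> real. \<forall>j. C j > 0 \<and> M j > 0 \<and> R j > 0 \<and>
      (\<forall>\<eta>. norm (lattice_vec \<eta>) \<ge> R j \<longrightarrow> norm (ev j \<eta>) \<ge> C j * norm (lattice_vec \<eta>) powr (- M j)))"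
    unfolding poly_bounded_below_def by metis
  finally show "globally_hypoelliptic (perturbed L Q \<epsilon>) \<longleftrightarrow>
      (\<exists>C M R :: 'm \<Rightarrow> real. \<forall>j. C j > 0 \<and> M j > 0 \<and> R j > 0 \<and>
         (\<forall>\<eta>. norm (lattice_vec \<eta>) \<ge> R j \<longrightarrow>
            norm (lam j \<eta> + (\<Sum>k. \<sigma> j (Suc k) \<eta> * \<epsilon> ^ Suc k)) \<ge> C j * norm (lattice_vec \<eta>) powr (- M j)))"
    unfolding ev_def .
qed

end
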